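(* Let $T>0$, $\alpha\in(0,1)$, $s\in(0,1)$, $H\in(0,1)$, let $D$ be a bounded domain with Lipschitz boundary, and let $h\in L^{\infty}([0,T])$ satisfy $h(t)\ge C_{h}>0$ for $t\in(0,T)$, with $C_h$ a constant. Let $f,g\in L^{2}(D)$ with $\|g\|_{L^{2}(D)}\neq0$. Then for all $\sigma_{1}\in[0,1]$ and all $\sigma_{2}\in[0,\min(\frac{H}{\alpha}-\epsilon,1)]$, with $\epsilon>0$ arbitrarily small, there is a constant $C>0$ such that for all $t\in(0,T]$ and all positive integers $k,l$, $$\left|\int_{0}^{t}E_{\alpha,1}(-\lambda_{k}^{s}(t-r)^{\alpha})h(r)\,dr\right|\le C\lambda_{k}^{-\sigma_{1}s}$$ and $$\mathbb{E}\left(\int_{0}^{t}E_{\alpha,1}(-\lambda_{k}^{s}(t-r)^{\alpha})\,dW^{H}(r)\int_{0}^{t}E_{\alpha,1}(-\lambda_{l}^{s}(t-r)^{\alpha})\,dW^{H}(r)\right)\le C\lambda_{k}^{-\sigma_{2}s}\lambda_{l}^{-\sigma_{2}s}.$$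
   Context: $\{\lambda_{k}\}_{k\ge1}$ are the nondecreasing eigenvalues of $A=-\Delta$ on $D$ with zero Dirichlet boundary condition. $E_{\alpha,\beta}(z)=\sum_{k=0}^{\infty}\frac{z^{k}}{\Gamma(k\alpha+\beta)}$ is the Mittag-Leffler function. $W^{H}$ is a one-dimensional fractional Brownian motion with Hurst index $H$ on a complete probability space (centered Gaussian, $\mathbb{E}[W^{H}(t)W^{H}(r)]=\frac12(t^{2H}+r^{2H}-|t-r|^{2H})$), $\mathbb{E}$ is expectation, and integrals of deterministic functions against $W^{H}$ are Wiener integrals. The functions $f,g$ are the source terms of the equation $\partial_{t}u+\partial^{1-\alpha}_{t}A^{s}u=f(x)h(t)+g(x)\dot W^{H}(t)$ (zero initial and Dirichlet boundary data) from which the two integrals arise; they do not appear in the estimates. *)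

theory Defs
  imports "HOL-Probability.Probability"
begin

section \<open>Mittag-Leffler function\<close>

definition mittag_leffler :: "real \<Rightarrow> real \<Rightarrow> 'a \<Rightarrow> 'a::{real_normed_field,banach}" where
  "mittag_leffler \<alpha> \<beta> z = (\<Sum>k. z ^ k /\<^sub>R Gamma (real k * \<alpha> + \<beta>))"

section \<open>Lebesgue spaces\<close>

definition L2 :: "'b measure \<Rightarrow> ('b \<Rightarrow> 'c::real_normed_vector) \<Rightarrow> bool" where
  "L2 M f \<longleftrightarrow> f \<in> borel_measurable M \<and> integrable M (\<lambda>x. (norm (f x))\<^sup>2)"

definition L2_norm :: "'b measure \<Rightarrow> ('b \<Rightarrow> 'c::real_normed_vector) \<Rightarrow> real" where
  "L2_norm M f = sqrt (\<integral>x. (norm (f x))\<^sup>2 \<partial>M)"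

definition L2_converges ::
    "'b measure \<Rightarrow> (nat \<Rightarrow> 'b \<Rightarrow> 'c::real_normed_vector) \<Rightarrow> ('b \<Rightarrow> 'c) \<Rightarrow> bool" where
  "L2_converges M F f \<longleftrightarrow> (\<forall>n. L2 M (F n)) \<and> L2 M f \<and>
     (\<lambda>n. L2_norm M (\<lambda>x. F n x - f x)) \<longlonglongrightarrow> 0"

definition Linfty :: "'b measure \<Rightarrow> ('b \<Rightarrow> real) \<Rightarrow> bool" where
  "Linfty M f \<longleftrightarrow> f \<in> borel_measurable M \<and> (\<exists>B. AE x in M. \<bar>f x\<bar> \<le> B)"

section \<open>Bounded Lipschitz domains\<close>

text \<open>Near every boundary point, in suitable rotated coordinates, the set is the part of a ball
  lying strictly above the graph of a Lipschitz function. The unit vector \<open>v\<close> is the vertical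
  direction, and \<open>y - (y \<bullet> v) *\<^sub>R v\<close> is the horizontal part of \<open>y\<close>.\<close>

definition lipschitz_boundary :: "'a::euclidean_space set \<Rightarrow> bool" where
  "lipschitz_boundary D \<longleftrightarrow>
     (\<forall>x\<in>frontier D. \<exists>r>0. \<exists>v. \<exists>\<gamma>::'a \<Rightarrow> real. \<exists>L. norm v = 1 \<and> L-lipschitz_on UNIV \<gamma> \<and>
        D \<inter> ball x r = {y \<in> ball x r. \<gamma> (y - (y \<bullet> v) *\<^sub>R v) < y \<bullet> v})"

definition bounded_lipschitz_domain :: "'a::euclidean_space set \<Rightarrow> bool" where
  "bounded_lipschitz_domain D \<longleftrightarrow>
     D \<noteq> {} \<and> open D \<and> connected D \<and> bounded D \<and> lipschitz_boundary D"

section \<open>The Dirichlet Laplacian\<close>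

primrec Ck :: "nat \<Rightarrow> ('a::euclidean_space \<Rightarrow> real) \<Rightarrow> bool" where
  "Ck 0 f \<longleftrightarrow> continuous_on UNIV f"
| "Ck (Suc n) f \<longleftrightarrow> (\<forall>x. f differentiable (at x)) \<and>
     (\<forall>v. Ck n (\<lambda>x. frechet_derivative f (at x) v))"

definition test_function :: "'a::euclidean_space set \<Rightarrow> ('a \<Rightarrow> real) \<Rightarrow> bool" where
  "test_function D \<phi> \<longleftrightarrow> (\<forall>n. Ck n \<phi>) \<and>
     compact (closure {x. \<phi> x \<noteq> 0}) \<and> closure {x. \<phi> x \<noteq> 0} \<subseteq> D"

definition gradient :: "('a::euclidean_space \<Rightarrow> real) \<Rightarrow> 'a \<Rightarrow> 'a" where
  "gradient \<phi> x = (\<Sum>b\<in>Basis. frechet_derivative \<phi> (at x) b *\<^sub>R b)"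

text \<open>\<open>H1 D u G\<close>: \<open>u\<close> belongs to the Sobolev space $H^1(D)$ and has weak gradient \<open>G\<close>.
  \<open>H10 D u G\<close>: moreover \<open>u\<close> lies in $H^1_0(D)$, the closure of the test functions.\<close>

definition H1 :: "'a::euclidean_space set \<Rightarrow> ('a \<Rightarrow> real) \<Rightarrow> ('a \<Rightarrow> 'a) \<Rightarrow> bool" where
  "H1 D u G \<longleftrightarrow> L2 (lebesgue_on D) u \<and> L2 (lebesgue_on D) G \<and>
     (\<forall>\<phi>. test_function D \<phi> \<longrightarrow>
        (\<integral>x. u x *\<^sub>R gradient \<phi> x \<partial>lebesgue_on D) = - (\<integral>x. \<phi> x *\<^sub>R G x \<partial>lebesgue_on D))"

definition H10 :: "'a::euclidean_space set \<Rightarrow> ('a \<Rightarrow> real) \<Rightarrow> ('a \<Rightarrow> 'a) \<Rightarrow> bool" where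
  "H10 D u G \<longleftrightarrow> H1 D u G \<and>
     (\<exists>\<phi>. (\<forall>n. test_function D (\<phi> n)) \<and>
        L2_converges (lebesgue_on D) \<phi> u \<and>
        L2_converges (lebesgue_on D) (\<lambda>n. gradient (\<phi> n)) G)"

text \<open>The graph of $A = -\Delta$ with zero Dirichlet boundary condition: $u \in H^1_0(D)$ and
  $-\Delta u = w \in L^2(D)$ in the sense of distributions.\<close>

definition dirichlet_laplacian ::
    "'a::euclidean_space set \<Rightarrow> ('a \<Rightarrow> real) \<Rightarrow> ('a \<Rightarrow> real) \<Rightarrow> bool" where
  "dirichlet_laplacian D u w \<longleftrightarrow> L2 (lebesgue_on D) w \<and>
     (\<exists>G. H10 D u G \<and>
        (\<forall>\<phi>. test_function D \<phi> \<longrightarrow>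
           (\<integral>x. G x \<bullet> gradient \<phi> x \<partial>lebesgue_on D) = (\<integral>x. w x * \<phi> x \<partial>lebesgue_on D)))"

definition eigenspace :: "'a::euclidean_space set \<Rightarrow> real \<Rightarrow> ('a \<Rightarrow> real) set" where
  "eigenspace D \<mu> = {u. dirichlet_laplacian D u (\<lambda>x. \<mu> * u x)}"

text \<open>Functions are identified when they agree almost everywhere on \<open>D\<close>, so the dimension is that of
  the quotient of the eigenspace by the null functions. It is \<open>0\<close> when \<open>\<mu>\<close> is not an eigenvalue.\<close>

definition eigenspace_has_dim :: "'a::euclidean_space set \<Rightarrow> real \<Rightarrow> nat \<Rightarrow> bool" where
  "eigenspace_has_dim D \<mu> n \<longleftrightarrow>
     (\<exists>b :: nat \<Rightarrow> 'a \<Rightarrow> real. (\<forall>i<n. b i \<in> eigenspace D \<mu>) \<and>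
        (\<forall>c. (AE x in lebesgue_on D. (\<Sum>i<n. c i * b i x) = 0) \<longrightarrow> (\<forall>i<n. c i = 0)) \<and>
        (\<forall>u\<in>eigenspace D \<mu>. \<exists>c. AE x in lebesgue_on D. u x = (\<Sum>i<n. c i * b i x)))"

text \<open>\<open>lam 1 \<le> lam 2 \<le> \<dots>\<close> lists the eigenvalues of the Dirichlet Laplacian, each as often as its
  multiplicity. The value \<open>lam 0\<close> is irrelevant.\<close>

definition dirichlet_eigenvalues :: "'a::euclidean_space set \<Rightarrow> (nat \<Rightarrow> real) \<Rightarrow> bool" where
  "dirichlet_eigenvalues D lam \<longleftrightarrow> mono_on {1..} lam \<and>
     (\<forall>\<mu>. finite {k. 1 \<le> k \<and> lam k = \<mu>} \<and> eigenspace_has_dim D \<mu> (card {k. 1 \<le> k \<and> lam k = \<mu>}))"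

section \<open>Fractional Brownian motion and Wiener integrals\<close>

definition gaussian_rv :: "'w measure \<Rightarrow> ('w \<Rightarrow> real) \<Rightarrow> bool" where
  "gaussian_rv M X \<longleftrightarrow> X \<in> borel_measurable M \<and>
     ((\<exists>\<mu> \<sigma>. 0 < \<sigma> \<and> distributed M lborel X (\<lambda>x. ennreal (normal_density \<mu> \<sigma> x))) \<or>
      (\<exists>c. AE \<omega> in M. X \<omega> = c))"

definition gaussian_process :: "'w measure \<Rightarrow> real set \<Rightarrow> (real \<Rightarrow> 'w \<Rightarrow> real) \<Rightarrow> bool" where
  "gaussian_process M I X \<longleftrightarrow>
     (\<forall>J c. finite J \<and> J \<subseteq> I \<longrightarrow> gaussian_rv M (\<lambda>\<omega>. \<Sum>t\<in>J. c t * X t \<omega>))"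

definition fractional_brownian_motion ::
    "'w measure \<Rightarrow> real \<Rightarrow> (real \<Rightarrow> 'w \<Rightarrow> real) \<Rightarrow> bool" where
  "fractional_brownian_motion M H W \<longleftrightarrow> gaussian_process M {0..} W \<and>
     (\<forall>t\<ge>0. (\<integral>\<omega>. W t \<omega> \<partial>M) = 0) \<and>
     (\<forall>t\<ge>0. \<forall>r\<ge>0. (\<integral>\<omega>. W t \<omega> * W r \<omega> \<partial>M) =
        (t powr (2 * H) + r powr (2 * H) - \<bar>t - r\<bar> powr (2 * H)) / 2)"

text \<open>A list of triples \<open>(a, u, v)\<close> encodes the step function $\sum a\,1_{(u,v]}$, whose integral
  is $\sum a\,(W(v) - W(u))$.\<close>

definition step_fun :: "(real \<times> real \<times> real) list \<Rightarrow> real \<Rightarrow> real" where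
  "step_fun S r = (\<Sum>(a, u, v)\<leftarrow>S. a * indicator {u<..v} r)"

definition step_integral ::
    "(real \<Rightarrow> 'w \<Rightarrow> real) \<Rightarrow> (real \<times> real \<times> real) list \<Rightarrow> 'w \<Rightarrow> real" where
  "step_integral W S \<omega> = (\<Sum>(a, u, v)\<leftarrow>S. a * (W v \<omega> - W u \<omega>))"

text \<open>The Wiener integral over $[0,t]$ is the $L^2(\Omega)$-limit of integrals of step functions that
  converge to the integrand in $L^2(0,t)$. For every Hurst index $H \in (0,1)$ the limit does not
  depend (up to null sets) on the step functions: the map from step functions to their integrals is
  bounded on $L^2(0,t)$ if $H \ge 1/2$, and for $H < 1/2$ it is closable, since then
  $\|\varphi\|_{L^2(0,t)} \le c\,\|\int_0^t \varphi\,dW\|_{L^2(\Omega)}$ for step functions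
  $\varphi$ on $[0,t]$. For $H > 1/2$ this covers the integrands in $L^2(0,t)$ only, a proper
  subspace of the largest possible class.\<close>

definition is_wiener_integral ::
    "'w measure \<Rightarrow> (real \<Rightarrow> 'w \<Rightarrow> real) \<Rightarrow> real \<Rightarrow> (real \<Rightarrow> real) \<Rightarrow> ('w \<Rightarrow> real) \<Rightarrow> bool" where
  "is_wiener_integral M W t \<phi> X \<longleftrightarrow>
     (\<exists>S. (\<forall>n. \<forall>(a, u, v) \<in> set (S n). 0 \<le> u \<and> u \<le> v \<and> v \<le> t) \<and>
        L2_converges (lebesgue_on {0..t}) (\<lambda>n. step_fun (S n)) \<phi> \<and>
        L2_converges M (\<lambda>n. step_integral W (S n)) X)"

definition wiener_integral ::
    "'w measure \<Rightarrow> (real \<Rightarrow> 'w \<Rightarrow> real) \<Rightarrow> real \<Rightarrow> (real \<Rightarrow> real) \<Rightarrow> 'w \<Rightarrow> real" where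
  "wiener_integral M W t \<phi> = (SOME X. is_wiener_integral M W t \<phi> X)"

end

theory Submission
  imports Defs
begin

text \<open>
  Put \<open>\<mu>\<^sub>k = \<lambda>\<^sub>k\<^sup>s\<close> and \<open>e(\<tau>) = E\<^sub>\<alpha>(- \<mu>\<^sub>k \<tau>\<^sup>\<alpha>)\<close>, where \<open>E\<^sub>\<alpha> = E\<^sub>\<alpha>\<^sub>,\<^sub>1\<close>. Both estimates rest on two properties of the
  Mittag-Leffler function: \<open>x \<mapsto> E\<^sub>\<alpha>(-x)\<close> is nonnegative and decreasing on the half-line, and
  \<open>E\<^sub>\<alpha>(-x) (1 + x / \<Gamma>(\<alpha> + 1)) \<le> 1\<close> (\<open>mittag_leffler_decay\<close>). Interpolating between the bounds
  \<open>1\<close> and \<open>\<Gamma>(\<alpha> + 1) / x\<close> shows \<open>e(\<tau>) \<le> c \<mu>\<^sub>k powr (- \<sigma>) \<tau> powr (- \<alpha> \<sigma>)\<close> for every \<open>\<sigma> \<in> [0, 1]\<close>.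
  The factor \<open>\<mu>\<^sub>k powr (- \<sigma>)\<close> is the claimed decay in \<open>\<lambda>\<^sub>k\<close>, so only the remaining power of \<open>\<tau>\<close> has to
  be integrated. For the first estimate this is \<open>\<integral> \<tau> powr (- \<alpha> \<sigma>\<^sub>1) d\<tau>\<close>, finite because
  \<open>\<alpha> \<sigma>\<^sub>1 < 1\<close>.

  The stochastic integral \<open>X = \<integral> e(t - r) dW(r)\<close> is estimated in the same way for all \<open>H\<close>. With \<open>b(\<tau>) = W(t) - W(t - \<tau>)\<close>, whose
  \<open>L\<^sup>2\<close> norm is \<open>\<tau>\<^sup>H\<close>, summation by parts gives \<open>X = e(t) b(t) + \<integral> b(\<tau>) (- de(\<tau>))\<close>. Since \<open>- de\<close> is
  a positive measure, the triangle inequality and a second summation by parts give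
  \<open>\<parallel>X\<parallel> \<le> e(t) t\<^sup>H + \<integral> \<tau>\<^sup>H (- de(\<tau>)) = \<integral> e(\<tau>) d(\<tau>\<^sup>H)\<close>, and after inserting the bound on \<open>e\<close> the
  last integral is finite exactly when \<open>\<alpha> \<sigma>\<^sub>2 < H\<close>. On step functions over uniform meshes this is an
  inequality between finite sums (\<open>mesh_integral_bound\<close>), and the integrals over successively halved
  meshes form a geometrically converging sequence (\<open>mesh_refinement_bound\<close>), so that the Wiener
  integral exists. It has to be the same whichever approximating step functions are used; this is
  the closability statement \<open>step_integral_closable\<close>. The mixed moment of two such integrals is then
  bounded by the Cauchy-Schwarz inequality.

  The properties of \<open>E\<^sub>\<alpha>\<close> are read off from a discretisation. The power series
  \<open>(1 - z)\<^bsup>\<alpha> - 1\<^esup> / ((1 - z)\<^sup>\<alpha> + m)\<close> has coefficients that are nonnegative, decrease in the index and in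
  \<open>m\<close>, and satisfy a discrete form of the decay bound; all of this follows from the signs of binomial
  coefficients. With \<open>m = x n powr (- \<alpha>)\<close> the \<open>n\<close>-th coefficient converges to \<open>E\<^sub>\<alpha>(-x)\<close>
  (\<open>discrete_ml_tendsto\<close>).

  Finally, \<open>\<lambda>\<^sub>k \<ge> \<lambda>\<^sub>1 > 0\<close> is needed for \<open>\<mu>\<^sub>k > 0\<close>; positivity of \<open>\<lambda>\<^sub>1\<close> follows from the Poincare inequality
  on bounded open sets.
\<close>

section \<open>Square-integrable functions\<close>

lemma L2_norm_nonneg: "0 \<le> L2_norm M F"
  by (simp add: L2_norm_def)

lemma L2_norm_squared: "(L2_norm M F)\<^sup>2 = (\<integral>x. (norm (F x))\<^sup>2 \<partial>M)"
  by (simp add: L2_norm_def)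

lemma L2_norm_fun: "L2 M F \<Longrightarrow> L2 M (\<lambda>x. norm (F x))"
  by (auto simp: L2_def)

lemma L2_add:
  fixes F G :: "'b \<Rightarrow> 'c::{real_normed_vector, second_countable_topology}"
  assumes "L2 M F" "L2 M G"
  shows "L2 M (\<lambda>x. F x + G x)"
proof -
  have [measurable]: "F \<in> borel_measurable M" "G \<in> borel_measurable M"
    using assms by (auto simp: L2_def)
  have int: "integrable M (\<lambda>x. 2 * (norm (F x))\<^sup>2 + 2 * (norm (G x))\<^sup>2)"
    using assms by (simp add: L2_def)
  have le: "norm ((norm (F x + G x))\<^sup>2) \<le> norm (2 * (norm (F x))\<^sup>2 + 2 * (norm (G x))\<^sup>2)" for x
  proof -
    have "(norm (F x + G x))\<^sup>2 \<le> (norm (F x) + norm (G x))\<^sup>2"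
      by (intro power_mono norm_triangle_ineq) simp
    also have "\<dots> \<le> 2 * (norm (F x))\<^sup>2 + 2 * (norm (G x))\<^sup>2"
      using zero_le_power2[of "norm (F x) - norm (G x)"] by (simp add: power2_sum power2_diff)
    finally show ?thesis by simp
  qed
  have "integrable M (\<lambda>x. (norm (F x + G x))\<^sup>2)"
    by (rule Bochner_Integration.integrable_bound[OF int _ AE_I2[OF le]]) measurable
  then show ?thesis by (simp add: L2_def)
qed

lemma L2_scaleR:
  fixes F :: "'b \<Rightarrow> 'c::{real_normed_vector, second_countable_topology}"
  assumes "L2 M F" shows "L2 M (\<lambda>x. c *\<^sub>R F x)"
  using assms by (auto simp: L2_def power_mult_distrib)

lemma L2_cmult:
  fixes F :: "'b \<Rightarrow> real"
  assumes "L2 M F" shows "L2 M (\<lambda>x. c * F x)"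
  using L2_scaleR[OF assms, of c] by simp

lemma L2_diff:
  fixes F G :: "'b \<Rightarrow> 'c::{real_normed_vector, second_countable_topology}"
  assumes "L2 M F" "L2 M G"
  shows "L2 M (\<lambda>x. F x - G x)"
  using L2_add[OF assms(1) L2_scaleR[OF assms(2), of "-1"]] by simp

lemma L2_zero: "L2 M (\<lambda>x. 0)"
  by (simp add: L2_def)

lemma L2_sum:
  fixes F :: "'i \<Rightarrow> 'b \<Rightarrow> 'c::{real_normed_vector, second_countable_topology}"
  assumes "\<And>i. i \<in> I \<Longrightarrow> L2 M (F i)"
  shows "L2 M (\<lambda>x. \<Sum>i\<in>I. F i x)"
  using assms by (induction I rule: infinite_finite_induct) (simp_all add: L2_zero L2_add)

lemma L2_mult_integrable:
  fixes X Y :: "'b \<Rightarrow> real"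
  assumes "L2 M X" "L2 M Y"
  shows "integrable M (\<lambda>x. X x * Y x)"
proof -
  have [measurable]: "X \<in> borel_measurable M" "Y \<in> borel_measurable M"
    using assms by (auto simp: L2_def)
  have int: "integrable M (\<lambda>x. (X x)\<^sup>2 + (Y x)\<^sup>2)"
    using assms by (simp add: L2_def)
  have le: "norm (X x * Y x) \<le> norm ((X x)\<^sup>2 + (Y x)\<^sup>2)" for x
  proof -
    have "2 * \<bar>X x * Y x\<bar> \<le> (X x)\<^sup>2 + (Y x)\<^sup>2"
      using sum_squares_bound[of "\<bar>X x\<bar>" "\<bar>Y x\<bar>"] by (simp add: abs_mult)
    then show ?thesis unfolding real_norm_def by linarith
  qed
  show ?thesis
    by (rule Bochner_Integration.integrable_bound[OF int _ AE_I2[OF le]]) measurable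
qed

text \<open>The quadratic polynomial \<open>t \<mapsto> \<integral> (X + t Y)\<^sup>2\<close> has no negative values, so its discriminant is not
  positive.\<close>

lemma L2_Cauchy_Schwarz:
  fixes X Y :: "'b \<Rightarrow> real"
  assumes X: "L2 M X" and Y: "L2 M Y"
  shows "\<bar>\<integral>x. X x * Y x \<partial>M\<bar> \<le> L2_norm M X * L2_norm M Y"
proof -
  define A B C where "A = (\<integral>x. (X x)\<^sup>2 \<partial>M)" "B = (\<integral>x. X x * Y x \<partial>M)" "C = (\<integral>x. (Y x)\<^sup>2 \<partial>M)"
  have [simp]: "integrable M (\<lambda>x. (X x)\<^sup>2)" "integrable M (\<lambda>x. (Y x)\<^sup>2)"
    using X Y by (auto simp: L2_def)
  have quad: "0 \<le> A + 2 * t * B + t\<^sup>2 * C" for t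
  proof -
    have "0 \<le> (\<integral>x. (X x + t * Y x)\<^sup>2 \<partial>M)" by simp
    also have "\<dots> = (\<integral>x. (X x)\<^sup>2 + (2 * t * (X x * Y x) + t\<^sup>2 * (Y x)\<^sup>2) \<partial>M)"
      by (intro Bochner_Integration.integral_cong) (auto simp: power2_sum power_mult_distrib algebra_simps)
    also have "\<dots> = A + 2 * t * B + t\<^sup>2 * C"
      using L2_mult_integrable[OF X Y] by (simp add: A_B_C_def)
    finally show ?thesis .
  qed
  have C: "0 \<le> C" by (simp add: A_B_C_def)
  have "B\<^sup>2 \<le> A * C"
  proof (cases "C = 0")
    case True
    have "B = 0"
    proof (rule ccontr)
      assume "B \<noteq> 0"
      then show False using quad[of "- (A + 1) / (2 * B)"] True by (simp add: field_simps)
    qed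
    then show ?thesis using True by simp
  next
    case False
    have "0 \<le> (A + 2 * (- B / C) * B + (- B / C)\<^sup>2 * C) * C" by (rule mult_nonneg_nonneg[OF quad C])
    also have "\<dots> = A * C - B\<^sup>2" using False by (simp add: field_simps power2_eq_square)
    finally show ?thesis by simp
  qed
  then have "sqrt (B\<^sup>2) \<le> sqrt (A * C)" by (rule real_sqrt_le_mono)
  then show ?thesis by (simp add: A_B_C_def L2_norm_def real_sqrt_mult)
qed

lemma L2_norm_triangle:
  fixes F G :: "'b \<Rightarrow> 'c::{real_normed_vector, second_countable_topology}"
  assumes F: "L2 M F" and G: "L2 M G"
  shows "L2_norm M (\<lambda>x. F x + G x) \<le> L2_norm M F + L2_norm M G"
proof (rule power2_le_imp_le)
  let ?f = "\<lambda>x. norm (F x)" and ?g = "\<lambda>x. norm (G x)"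
  have fg: "L2 M ?f" "L2 M ?g" using F G by (simp_all add: L2_norm_fun)
  then have "L2 M (\<lambda>x. ?f x + ?g x)" by (rule L2_add)
  then have int: "integrable M (\<lambda>x. (?f x + ?g x)\<^sup>2)" by (simp add: L2_def)
  have "(L2_norm M (\<lambda>x. F x + G x))\<^sup>2 \<le> (\<integral>x. (?f x + ?g x)\<^sup>2 \<partial>M)"
    unfolding L2_norm_squared using int by (intro integral_mono') (auto intro!: power_mono norm_triangle_ineq)
  also have "\<dots> = (\<integral>x. (?f x)\<^sup>2 + (2 * (?f x * ?g x) + (?g x)\<^sup>2) \<partial>M)"
    by (intro Bochner_Integration.integral_cong) (auto simp: power2_sum)
  also have "\<dots> = (L2_norm M F)\<^sup>2 + (2 * (\<integral>x. ?f x * ?g x \<partial>M) + (L2_norm M G)\<^sup>2)"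
    using F G L2_mult_integrable[OF fg] by (simp add: L2_norm_squared L2_def)
  also have "\<dots> \<le> (L2_norm M F)\<^sup>2 + (2 * (L2_norm M F * L2_norm M G) + (L2_norm M G)\<^sup>2)"
    using L2_Cauchy_Schwarz[OF fg] by (simp add: L2_norm_def)
  finally show "(L2_norm M (\<lambda>x. F x + G x))\<^sup>2 \<le> (L2_norm M F + L2_norm M G)\<^sup>2"
    by (simp add: power2_sum)
qed (simp add: L2_norm_nonneg)

lemma L2_norm_scaleR: "L2_norm M (\<lambda>x. c *\<^sub>R F x) = \<bar>c\<bar> * L2_norm M F"
  by (simp add: L2_norm_def power_mult_distrib real_sqrt_mult)

lemma L2_norm_cmult: "L2_norm M (\<lambda>x. c * F x) = \<bar>c\<bar> * L2_norm M F" for F :: "'b \<Rightarrow> real"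
  using L2_norm_scaleR[of M c F] by simp

lemma L2_norm_minus_commute: "L2_norm M (\<lambda>x. F x - G x) = L2_norm M (\<lambda>x. G x - F x)"
  by (simp add: L2_norm_def norm_minus_commute)

lemma L2_norm_triangle3:
  fixes F G K :: "'b \<Rightarrow> 'c::{real_normed_vector, second_countable_topology}"
  assumes "L2 M F" "L2 M G" "L2 M K"
  shows "L2_norm M (\<lambda>x. F x - K x) \<le> L2_norm M (\<lambda>x. F x - G x) + L2_norm M (\<lambda>x. G x - K x)"
  using L2_norm_triangle[OF L2_diff[OF assms(1,2)] L2_diff[OF assms(2,3)]] by simp

lemma L2_norm_sum_le:
  fixes F :: "'i \<Rightarrow> 'b \<Rightarrow> 'c::{real_normed_vector, second_countable_topology}"
  assumes "\<And>i. i \<in> I \<Longrightarrow> L2 M (F i)"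
  shows "L2_norm M (\<lambda>x. \<Sum>i\<in>I. F i x) \<le> (\<Sum>i\<in>I. L2_norm M (F i))"
  using assms
proof (induction I rule: infinite_finite_induct)
  case (insert i I)
  have "L2_norm M (\<lambda>x. F i x + (\<Sum>i\<in>I. F i x)) \<le> L2_norm M (F i) + L2_norm M (\<lambda>x. \<Sum>i\<in>I. F i x)"
    using insert.prems by (intro L2_norm_triangle L2_sum) auto
  then show ?case using insert by force
qed (simp_all add: L2_norm_def)

lemma L2_norm_eq_0_AE:
  assumes "L2 M F" "L2_norm M F = 0"
  shows "AE x in M. F x = 0"
proof -
  have "(\<integral>x. (norm (F x))\<^sup>2 \<partial>M) = 0" using assms(2) by (simp add: L2_norm_def)
  then show ?thesis using assms(1) by (subst (asm) integral_nonneg_eq_0_iff_AE) (auto simp: L2_def)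
qed

lemma L2_norm_tendsto:
  fixes F :: "nat \<Rightarrow> 'b \<Rightarrow> 'c::{real_normed_vector, second_countable_topology}"
  assumes "L2_converges M F f"
  shows "(\<lambda>n. L2_norm M (F n)) \<longlonglongrightarrow> L2_norm M f"
proof -
  have L: "L2 M (F n)" "L2 M f" for n using assms by (auto simp: L2_converges_def)
  have bound: "norm (L2_norm M (F n) - L2_norm M f) \<le> L2_norm M (\<lambda>x. F n x - f x)" for n
    using L2_norm_triangle3[OF L(1)[of n] L(2) L2_zero] L2_norm_triangle3[OF L(2) L(1)[of n] L2_zero]
    by (simp add: L2_norm_minus_commute[of M f] abs_le_iff)
  have "(\<lambda>n. L2_norm M (\<lambda>x. F n x - f x)) \<longlonglongrightarrow> 0" using assms by (simp add: L2_converges_def)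
  then have "(\<lambda>n. L2_norm M (F n) - L2_norm M f) \<longlonglongrightarrow> 0"
    by (rule Lim_null_comparison[OF always_eventually[OF allI[OF bound]]])
  then show ?thesis by (simp add: LIM_zero_iff)
qed

lemma L2_converges_diff:
  fixes F G :: "nat \<Rightarrow> 'b \<Rightarrow> 'c::{real_normed_vector, second_countable_topology}"
  assumes "L2_converges M F f" "L2_converges M G g"
  shows "L2_converges M (\<lambda>n x. F n x - G n x) (\<lambda>x. f x - g x)"
proof -
  have L: "L2 M (F n)" "L2 M f" "L2 M (G n)" "L2 M g" for n using assms by (auto simp: L2_converges_def)
  have *: "norm (L2_norm M (\<lambda>x. F n x - G n x - (f x - g x))) \<le>
      L2_norm M (\<lambda>x. F n x - f x) + L2_norm M (\<lambda>x. G n x - g x)" for n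
    using L2_norm_triangle[OF L2_diff[OF L(1)[of n] L(2)] L2_diff[OF L(4) L(3)[of n]]]
    by (simp add: L2_norm_minus_commute[of M g] L2_norm_nonneg algebra_simps)
  have "(\<lambda>n. L2_norm M (\<lambda>x. F n x - f x) + L2_norm M (\<lambda>x. G n x - g x)) \<longlonglongrightarrow> 0 + 0"
    using assms by (intro tendsto_add) (auto simp: L2_converges_def)
  then have "(\<lambda>n. L2_norm M (\<lambda>x. F n x - G n x - (f x - g x))) \<longlonglongrightarrow> 0"
    unfolding add_0 by (rule Lim_null_comparison[OF always_eventually[OF allI[OF *]]])
  then show ?thesis using L by (simp add: L2_converges_def L2_diff)
qed

text \<open>The usual completeness proof for \<open>L\<^sup>2\<close>, in the only case used here. The increments have summable
  \<open>L\<^sup>1\<close> norms, hence the sequence converges almost everywhere; Fatou's lemma turns the uniform bounds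
  on \<open>X\<^sub>n\<^sub>+\<^sub>m - X\<^sub>n\<close> into bounds on the distance from the limit.\<close>

lemma L2_complete_geometric:
  fixes X :: "nat \<Rightarrow> 'b \<Rightarrow> real"
  assumes M: "prob_space M" and L: "\<And>n. L2 M (X n)" and q: "0 \<le> q" "q < 1" and K: "0 \<le> K"
    and step: "\<And>n. L2_norm M (\<lambda>x. X (Suc n) x - X n x) \<le> K * q ^ n"
  shows "\<exists>Y. L2_converges M X Y"
proof -
  interpret prob_space M by fact
  have [measurable]: "X n \<in> borel_measurable M" for n using L by (simp add: L2_def)
  define D where "D n x = \<bar>X (Suc n) x - X n x\<bar>" for n x
  have [measurable]: "D n \<in> borel_measurable M" for n unfolding D_def by measurable
  have LD: "L2 M (D n)" for n
    unfolding D_def using L2_norm_fun[OF L2_diff[OF L L]] by simp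
  have L1: "L2 M (\<lambda>x. 1::real)" by (simp add: L2_def)
  have N1: "L2_norm M (\<lambda>x. 1::real) = 1" by (simp add: L2_norm_def prob_space)
  have intD: "integrable M (D n)" for n using L2_mult_integrable[OF LD L1, of n] by simp
  have "(\<integral>\<^sup>+x. ennreal (D n x) \<partial>M) \<le> ennreal (K * q ^ n)" for n
  proof -
    have "(\<integral>\<^sup>+x. ennreal (D n x) \<partial>M) = ennreal (\<integral>x. D n x \<partial>M)"
      by (rule nn_integral_eq_integral[OF intD]) (simp add: D_def)
    also have "(\<integral>x. D n x \<partial>M) \<le> L2_norm M (D n)"
      using L2_Cauchy_Schwarz[OF LD L1, of n] by (simp add: N1)
    also have "L2_norm M (D n) \<le> K * q ^ n" using step[of n] by (simp add: D_def L2_norm_def)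
    finally show ?thesis by (simp add: ennreal_leI)
  qed
  then have "(\<integral>\<^sup>+x. (\<Sum>n. ennreal (D n x)) \<partial>M) \<le> (\<Sum>n. ennreal (K * q ^ n))"
    by (subst nn_integral_suminf) (auto intro!: suminf_le)
  also have "\<dots> < \<infinity>"
    using q K by (subst suminf_ennreal2) (auto intro!: summable_mult summable_geometric)
  finally have "AE x in M. (\<Sum>n. ennreal (D n x)) \<noteq> \<infinity>"
    by (intro nn_integral_PInf_AE) auto
  then have conv: "AE x in M. (\<lambda>n. X n x) \<longlonglongrightarrow> lim (\<lambda>n. X n x)"
  proof eventually_elim
    case (elim x)
    then have "summable (\<lambda>n. D n x)" by (intro summable_suminf_not_top) (auto simp: D_def)
    then have "summable (\<lambda>n. X (Suc n) x - X n x)" unfolding D_def by (rule summable_rabs_cancel)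
    then have "convergent (\<lambda>n. \<Sum>i<n. X (Suc i) x - X i x)" by (simp add: summable_iff_convergent)
    then have "convergent (\<lambda>n. X n x - X 0 x)" by (simp only: sum_lessThan_telescope[of "\<lambda>n. X n x"])
    then have "convergent (\<lambda>n. X n x)" by (simp add: convergent_diff_const_right_iff)
    then show ?case by (simp add: convergent_LIMSEQ_iff)
  qed
  define Y where "Y x = lim (\<lambda>n. X n x)" for x
  have [measurable]: "Y \<in> borel_measurable M" unfolding Y_def by measurable
  define R where "R n = K * q ^ n / (1 - q)" for n
  have R0: "0 \<le> R n" for n using q K by (simp add: R_def)
  have tail: "L2_norm M (\<lambda>x. X (n + m) x - X n x) \<le> R n" for n m
  proof -
    have "L2_norm M (\<lambda>x. X (n + m) x - X n x) \<le> (\<Sum>i<m. K * q ^ (n + i))"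
    proof (induction m)
      case (Suc m)
      show ?case using L2_norm_triangle3[OF L[of "n + Suc m"] L[of "n + m"] L[of n]] step[of "n + m"] Suc by simp
    qed (simp add: L2_norm_def)
    also have "\<dots> = K * q ^ n * (\<Sum>i<m. q ^ i)" by (simp add: power_add sum_distrib_left mult_ac)
    also have "\<dots> \<le> K * q ^ n * (1 / (1 - q))"
    proof (intro mult_left_mono)
      show "(\<Sum>i<m. q ^ i) \<le> 1 / (1 - q)"
        using sum_le_suminf[OF summable_geometric, of q "{..<m}"] q suminf_geometric[of q] by simp
    qed (use q K in auto)
    finally show ?thesis by (simp add: R_def)
  qed
  have fatou: "L2 M (\<lambda>x. Y x - X n x) \<and> L2_norm M (\<lambda>x. Y x - X n x) \<le> R n" for n
  proof -
    have "(\<integral>\<^sup>+x. ennreal ((Y x - X n x)\<^sup>2) \<partial>M) = (\<integral>\<^sup>+x. liminf (\<lambda>m. ennreal ((X (n + m) x - X n x)\<^sup>2)) \<partial>M)"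
    proof (rule nn_integral_cong_AE)
      show "AE x in M. ennreal ((Y x - X n x)\<^sup>2) = liminf (\<lambda>m. ennreal ((X (n + m) x - X n x)\<^sup>2))"
        using conv
      proof eventually_elim
        case (elim x)
        then have "(\<lambda>m. X (n + m) x) \<longlonglongrightarrow> Y x"
          using LIMSEQ_ignore_initial_segment[OF elim, of n] by (simp only: Y_def add.commute[of n])
        then have "(\<lambda>m. ennreal ((X (n + m) x - X n x)\<^sup>2)) \<longlonglongrightarrow> ennreal ((Y x - X n x)\<^sup>2)"
          by (intro tendsto_ennrealI tendsto_intros)
        then show ?case by (intro lim_imp_Liminf[symmetric]) auto
      qed
    qed
    also have "\<dots> \<le> liminf (\<lambda>m. \<integral>\<^sup>+x. ennreal ((X (n + m) x - X n x)\<^sup>2) \<partial>M)"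
      by (intro nn_integral_liminf) measurable
    also have "\<dots> \<le> liminf (\<lambda>m::nat. ennreal ((R n)\<^sup>2))"
    proof (intro Liminf_mono always_eventually allI)
      fix m
      have "L2 M (\<lambda>x. X (n + m) x - X n x)" by (intro L2_diff L)
      then have "(\<integral>\<^sup>+x. ennreal ((X (n + m) x - X n x)\<^sup>2) \<partial>M) = ennreal ((L2_norm M (\<lambda>x. X (n + m) x - X n x))\<^sup>2)"
        unfolding L2_norm_squared by (subst nn_integral_eq_integral) (auto simp: L2_def)
      also have "\<dots> \<le> ennreal ((R n)\<^sup>2)"
        using tail by (intro ennreal_leI power_mono L2_norm_nonneg)
      finally show "(\<integral>\<^sup>+x. ennreal ((X (n + m) x - X n x)\<^sup>2) \<partial>M) \<le> ennreal ((R n)\<^sup>2)" .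
    qed
    also have "\<dots> = ennreal ((R n)\<^sup>2)" by (simp add: Liminf_const)
    finally have le: "(\<integral>\<^sup>+x. ennreal ((Y x - X n x)\<^sup>2) \<partial>M) \<le> ennreal ((R n)\<^sup>2)" .
    have int: "integrable M (\<lambda>x. (Y x - X n x)\<^sup>2)"
      by (rule integrableI_bounded) (use le in \<open>auto simp: le_less_trans\<close>)
    then have "(\<integral>x. (Y x - X n x)\<^sup>2 \<partial>M) \<le> (R n)\<^sup>2"
      using le by (subst (asm) nn_integral_eq_integral) auto
    then have "L2_norm M (\<lambda>x. Y x - X n x) \<le> R n"
      using R0[of n] by (simp add: L2_norm_def real_le_lsqrt)
    then show ?thesis using int by (simp add: L2_def)
  qed
  have "L2 M Y" using L2_add[OF conjunct1[OF fatou[of 0]] L[of 0]] by simp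
  moreover have "(\<lambda>n. L2_norm M (\<lambda>x. X n x - Y x)) \<longlonglongrightarrow> 0"
  proof (rule Lim_null_comparison)
    show "\<forall>\<^sub>F n in sequentially. norm (L2_norm M (\<lambda>x. X n x - Y x)) \<le> R n"
      using fatou by (simp add: L2_norm_minus_commute[of M _ Y] L2_norm_nonneg)
    show "R \<longlonglongrightarrow> 0" unfolding R_def using q
      by (intro tendsto_eq_intros LIMSEQ_power_zero) auto
  qed
  ultimately show ?thesis using L by (auto simp: L2_converges_def)
qed

lemma borel_imp_lebesgue_on:
  "f \<in> borel_measurable borel \<Longrightarrow> f \<in> borel_measurable (lebesgue_on A)"
  by (intro measurable_restrict_space1 measurable_completion) simp

lemma integral_lebesgue_on_borel:
  fixes f :: "'a::euclidean_space \<Rightarrow> real"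
  assumes "A \<in> sets borel" and "f \<in> borel_measurable borel"
  shows "(\<integral>x. f x \<partial>lebesgue_on A) = (\<integral>x. indicator A x * f x \<partial>lborel)"
proof -
  have [measurable]: "A \<in> sets borel" "f \<in> borel_measurable borel" using assms .
  have "(\<integral>x. f x \<partial>lebesgue_on A) = (\<integral>x. indicator A x *\<^sub>R f x \<partial>lebesgue)"
    using assms(1) by (intro integral_restrict_space) simp
  also have "\<dots> = (\<integral>x. indicator A x *\<^sub>R f x \<partial>lborel)"
    by (intro integral_completion) measurable
  finally show ?thesis by simp
qed

section \<open>The Mittag-Leffler function on the negative half-line\<close>

text \<open>The power series \<open>(1 - z)\<^bsup>-b\<^esup>\<close>.\<close>

definition fps_neg_binom :: "real \<Rightarrow> real fps" where
  "fps_neg_binom b = Abs_fps (\<lambda>n. pochhammer b n / fact n)"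

lemma fps_neg_binom_nth: "fps_nth (fps_neg_binom b) n = pochhammer b n / fact n"
  by (simp add: fps_neg_binom_def)

lemma fps_neg_binom_add: "fps_neg_binom (a + b) = fps_neg_binom a * fps_neg_binom b"
proof (rule fps_ext)
  fix n
  have "fps_nth (fps_neg_binom a * fps_neg_binom b) n =
      (\<Sum>k\<le>n. pochhammer a k / fact k * (pochhammer b (n - k) / fact (n - k)))"
    by (simp add: fps_mult_nth fps_neg_binom_nth atLeast0AtMost)
  also have "\<dots> = (\<Sum>k\<le>n. real (n choose k) * pochhammer a k * pochhammer b (n - k) / fact n)"
    by (intro sum.cong refl) (simp add: binomial_fact)
  also have "\<dots> = pochhammer (a + b) n / fact n"
    by (simp add: pochhammer_binomial_sum sum_divide_distrib)
  finally show "fps_nth (fps_neg_binom (a + b)) n = fps_nth (fps_neg_binom a * fps_neg_binom b) n"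
    by (simp add: fps_neg_binom_nth)
qed

lemma fps_neg_binom_0: "fps_neg_binom 0 = 1"
  by (rule fps_ext) (simp add: fps_neg_binom_nth pochhammer_0_left)

text \<open>Multiplication by \<open>1 / (1 - z)\<close> replaces coefficients by their partial sums.\<close>

lemma fps_neg_binom_1_mult_nth: "fps_nth (fps_neg_binom 1 * f) n = (\<Sum>j\<le>n. fps_nth f j)"
proof -
  have "fps_nth (fps_neg_binom 1 * f) n = (\<Sum>i=0..n. fps_nth f (n - i))"
    by (simp add: fps_mult_nth fps_neg_binom_nth pochhammer_fact[symmetric])
  also have "\<dots> = (\<Sum>j\<le>n. fps_nth f j)"
    unfolding atLeast0AtMost by (rule sum.nat_diff_reindex[of _ "Suc n", simplified lessThan_Suc_atMost, simplified]) 
  finally show ?thesis .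
qed

lemma fps_neg_binom_nonneg: "0 \<le> b \<Longrightarrow> 0 \<le> fps_nth (fps_neg_binom b) n"
  by (cases "b = 0") (auto simp: fps_neg_binom_nth pochhammer_0_left less_imp_le pochhammer_pos)

lemma fps_neg_binom_minus_nonpos:
  assumes "0 < a" "a < 1" "0 < n"
  shows "fps_nth (fps_neg_binom (- a)) n \<le> 0"
proof -
  obtain j where n: "n = Suc j" using assms by (cases n) auto
  have "0 < pochhammer (1 - a) j" using assms by (intro pochhammer_pos) simp
  then show ?thesis using assms
    by (simp add: fps_neg_binom_nth n pochhammer_rec divide_nonpos_pos mult_nonneg_nonneg)
qed

lemma fps_mult_nonneg:
  fixes f g :: "real fps"
  assumes "\<And>n. 0 \<le> fps_nth f n" "\<And>n. 0 \<le> fps_nth g n"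
  shows "0 \<le> fps_nth (f * g) n"
  by (simp add: fps_mult_nth sum_nonneg assms)

text \<open>Such a series is \<open>f\<^sub>0 - g\<close> with \<open>g \<ge> 0\<close> coefficientwise, and \<open>1 / (f\<^sub>0 - g)\<close> is a geometric series
  in \<open>g / f\<^sub>0\<close>.\<close>

lemma fps_inverse_nonneg:
  fixes f :: "real fps"
  assumes f0: "0 < fps_nth f 0" and fn: "\<And>n. 0 < n \<Longrightarrow> fps_nth f n \<le> 0"
  shows "0 \<le> fps_nth (inverse f) n"
proof (induction n rule: less_induct)
  case (less n)
  show ?case
  proof (cases "n = 0")
    case False
    have "(\<Sum>i=0..n. fps_nth f i * fps_nth (inverse f) (n - i)) = fps_nth (f * inverse f) n"
      by (simp add: fps_mult_nth)
    also have "\<dots> = 0" using f0 False by (simp add: inverse_mult_eq_1')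
    finally have "fps_nth f 0 * fps_nth (inverse f) n =
        - (\<Sum>i=1..n. fps_nth f i * fps_nth (inverse f) (n - i))"
      by (simp add: sum.atLeast_Suc_atMost)
    moreover have "(\<Sum>i=1..n. fps_nth f i * fps_nth (inverse f) (n - i)) \<le> 0"
      using less fn False by (intro sum_nonpos mult_nonpos_nonneg) auto
    ultimately show ?thesis using f0
      by (metis neg_0_le_iff_le zero_le_mult_iff not_less)
  qed (use f0 in simp)
qed

text \<open>The series \<open>1 / ((1 - z)\<^sup>a + m)\<close>.\<close>

definition resolvent :: "real \<Rightarrow> real \<Rightarrow> real fps" where
  "resolvent a m = inverse (fps_neg_binom (- a) + fps_const m)"

text \<open>The series \<open>(1 - z)\<^bsup>a - 1\<^esup> / ((1 - z)\<^sup>a + m)\<close>. Its coefficients solve the discretisation, with step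
  \<open>\<delta>\<close> and \<open>m = \<mu> \<delta>\<^sup>a\<close>, of the fractional relaxation equation \<open>D\<^sup>a e = - \<mu> e\<close>, \<open>e(0) = 1\<close>, whose solution is
  \<open>E\<^sub>a(- \<mu> \<tau>\<^sup>a)\<close>.\<close>

definition discrete_ml :: "real \<Rightarrow> real \<Rightarrow> real fps" where
  "discrete_ml a m = fps_neg_binom (1 - a) * resolvent a m"

context
  fixes a :: real
  assumes a: "0 < a" "a < 1"
begin

lemma resolvent_mult: "0 \<le> m \<Longrightarrow> (fps_neg_binom (- a) + fps_const m) * resolvent a m = 1"
  unfolding resolvent_def by (rule inverse_mult_eq_1') (simp add: fps_neg_binom_nth)

text \<open>For \<open>0 < a < 1\<close> all coefficients of \<open>(1 - z)\<^sup>a\<close> except the constant one are nonpositive.\<close>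

lemma resolvent_nonneg: "0 \<le> m \<Longrightarrow> 0 \<le> fps_nth (resolvent a m) n"
  unfolding resolvent_def using a
  by (intro fps_inverse_nonneg) (auto simp: fps_neg_binom_nth[of _ 0] fps_neg_binom_minus_nonpos)

lemma discrete_ml_nonneg: "0 \<le> m \<Longrightarrow> 0 \<le> fps_nth (discrete_ml a m) n"
  unfolding discrete_ml_def using a
  by (intro fps_mult_nonneg fps_neg_binom_nonneg resolvent_nonneg) auto

text \<open>The resolvent identity \<open>R\<^sub>m - R\<^sub>m' = (m' - m) R\<^sub>m R\<^sub>m'\<close>, multiplied by \<open>(1 - z)\<^bsup>a - 1\<^esup>\<close>, shows that the
  difference is a product of series with nonnegative coefficients.\<close>

lemma discrete_ml_antimono:
  assumes "0 \<le> m" "m \<le> m'"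
  shows "fps_nth (discrete_ml a m') n \<le> fps_nth (discrete_ml a m) n"
proof -
  let ?P = "fps_neg_binom (- a)"
  have "resolvent a m - resolvent a m' =
     resolvent a m * ((?P + fps_const m') * resolvent a m') - (?P + fps_const m) * resolvent a m * resolvent a m'"
    using assms by (simp add: resolvent_mult)
  also have "\<dots> = fps_const (m' - m) * (resolvent a m * resolvent a m')"
    by (simp add: algebra_simps flip: fps_const_sub)
  finally have "discrete_ml a m - discrete_ml a m' =
      fps_const (m' - m) * (discrete_ml a m * resolvent a m')"
    unfolding discrete_ml_def by (metis mult.assoc mult.left_commute right_diff_distrib)
  then have "fps_nth (discrete_ml a m - discrete_ml a m') n =
      (m' - m) * fps_nth (discrete_ml a m * resolvent a m') n" by simp
  moreover have "0 \<le> fps_nth (discrete_ml a m * resolvent a m') n"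
    using assms by (intro fps_mult_nonneg discrete_ml_nonneg resolvent_nonneg) auto
  ultimately show ?thesis using assms
    by (metis diff_ge_0_iff_ge fps_sub_nth mult_nonneg_nonneg)
qed

text \<open>The consecutive differences are the coefficients of \<open>(1 - z)\<^sup>a R\<^sub>m = 1 - m R\<^sub>m\<close>, which are
  nonpositive from index \<open>1\<close> on.\<close>

lemma discrete_ml_decseq:
  assumes "0 \<le> m" "j \<le> n"
  shows "fps_nth (discrete_ml a m) n \<le> fps_nth (discrete_ml a m) j"
proof -
  let ?P = "fps_neg_binom (- a)"
  have "discrete_ml a m = fps_neg_binom 1 * (?P * resolvent a m)"
    by (simp add: discrete_ml_def fps_neg_binom_add[of 1 "- a", simplified] mult.assoc)
  also have "?P * resolvent a m = 1 - fps_const m * resolvent a m"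
    using resolvent_mult[OF assms(1)] by (simp add: algebra_simps eq_diff_eq)
  finally have eq: "fps_nth (discrete_ml a m) n =
      (\<Sum>j\<le>n. fps_nth (1 - fps_const m * resolvent a m) j)" for n
    by (simp add: fps_neg_binom_1_mult_nth)
  have "(\<Sum>i\<le>n. fps_nth (1 - fps_const m * resolvent a m) i)
     = (\<Sum>i\<le>j. fps_nth (1 - fps_const m * resolvent a m) i)
        + (\<Sum>i\<in>{j<..n}. fps_nth (1 - fps_const m * resolvent a m) i)"
    by (subst sum.union_disjoint[symmetric]) (use assms in \<open>auto intro!: sum.cong\<close>)
  moreover have "(\<Sum>i\<in>{j<..n}. fps_nth (1 - fps_const m * resolvent a m) i) \<le> 0"
    using assms resolvent_nonneg by (intro sum_nonpos) auto
  ultimately show ?thesis by (simp add: eq)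
qed

text \<open>The discrete analogue of the Volterra equation \<open>e + \<mu> I\<^sup>a e = 1\<close>, where \<open>I\<^sup>a\<close> denotes the fractional
  integral.\<close>

lemma discrete_ml_equation:
  assumes "0 \<le> m"
  shows "(1 + fps_const m * fps_neg_binom a) * discrete_ml a m = fps_neg_binom 1"
proof -
  have 1: "fps_neg_binom a * fps_neg_binom (- a) = 1"
    by (simp add: fps_neg_binom_0 flip: fps_neg_binom_add)
  have "(1 + fps_const m * fps_neg_binom a) = fps_neg_binom a * (fps_neg_binom (- a) + fps_const m)"
    using 1 by (simp add: algebra_simps)
  then have "(1 + fps_const m * fps_neg_binom a) * discrete_ml a m =
     fps_neg_binom a * fps_neg_binom (1 - a) * ((fps_neg_binom (- a) + fps_const m) * resolvent a m)"
    by (simp add: discrete_ml_def mult_ac)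
  also have "\<dots> = fps_neg_binom 1"
    using assms by (simp add: resolvent_mult flip: fps_neg_binom_add)
  finally show ?thesis .
qed

text \<open>In the discrete Volterra equation, bound every value of the solution inside the fractional
  integral from below by the last one.\<close>

lemma discrete_ml_bound:
  assumes m: "0 \<le> m"
  shows "fps_nth (discrete_ml a m) n * (1 + m * fps_nth (fps_neg_binom (a + 1)) n) \<le> 1"
proof -
  let ?w = "fps_nth (discrete_ml a m)" and ?c = "fps_nth (fps_neg_binom a)"
  have "?w n * fps_nth (fps_neg_binom (a + 1)) n = (\<Sum>j\<le>n. ?w n * ?c j)"
    by (simp add: add.commute[of a] fps_neg_binom_add fps_neg_binom_1_mult_nth sum_distrib_left)
  also have "\<dots> \<le> (\<Sum>j\<le>n. ?c j * ?w (n - j))"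
    using a m by (intro sum_mono)
      (auto simp: mult.commute[of "?w n"] intro!: mult_left_mono discrete_ml_decseq fps_neg_binom_nonneg)
  also have "\<dots> = fps_nth (fps_neg_binom a * discrete_ml a m) n"
    by (simp add: fps_mult_nth atLeast0AtMost)
  finally have *: "?w n * fps_nth (fps_neg_binom (a + 1)) n \<le> fps_nth (fps_neg_binom a * discrete_ml a m) n" .
  have "fps_nth ((1 + fps_const m * fps_neg_binom a) * discrete_ml a m) n = 1"
    by (simp add: discrete_ml_equation[OF m] fps_neg_binom_nth pochhammer_fact[symmetric])
  then have "?w n + m * fps_nth (fps_neg_binom a * discrete_ml a m) n = 1"
    by (simp add: distrib_right mult.assoc)
  then show ?thesis using mult_left_mono[OF * m] by (simp add: algebra_simps)
qed

text \<open>The coefficient on the left is a partial sum of \<open>(1 - z)\<^bsup>-b\<^esup>\<close>; since \<open>r\<^sup>n \<le> r\<^sup>j\<close> for \<open>j \<le> n\<close>, it is bounded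
  by the value of this series at \<open>r\<close>. Bounding a single coefficient of \<open>(1 - z)\<^bsup>- b - 1\<^esup>\<close> directly by the
  value of that series would lose a factor \<open>1 / (1 - r)\<close>, which is of order \<open>n\<close> in the limit below.\<close>

lemma fps_neg_binom_le_powr:
  assumes b: "0 \<le> b" and r: "0 < r" "r < 1"
  shows "fps_nth (fps_neg_binom (b + 1)) n * r ^ n \<le> (1 - r) powr (- b)"
proof -
  have sums: "(\<lambda>n. fps_nth (fps_neg_binom b) n * r ^ n) sums (1 - r) powr (- b)"
    using gen_binomial_real[of "- r" "- b"] r
    by (simp add: gbinomial_pochhammer fps_neg_binom_nth mult_ac flip: power_mult_distrib)
  have "fps_nth (fps_neg_binom (b + 1)) n * r ^ n = (\<Sum>j\<le>n. fps_nth (fps_neg_binom b) j * r ^ n)"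
    by (simp add: add.commute[of b] fps_neg_binom_add fps_neg_binom_1_mult_nth sum_distrib_right)
  also have "\<dots> \<le> (\<Sum>j\<le>n. fps_nth (fps_neg_binom b) j * r ^ j)"
    using r b by (intro sum_mono mult_left_mono power_decreasing fps_neg_binom_nonneg) auto
  also have "\<dots> \<le> (1 - r) powr (- b)"
    unfolding sums_unique[OF sums] using r b
    by (intro sum_le_suminf sums_summable[OF sums] mult_nonneg_nonneg fps_neg_binom_nonneg) auto
  finally show ?thesis .
qed

text \<open>Expand \<open>(1 - z)\<^bsup>-1\<^esup> / (1 + m (1 - z)\<^bsup>-a\<^esup>)\<close> in powers of \<open>m\<close>. As formal power series in \<open>z\<close> the terms
  do not tend to zero, so the expansion is an analytic statement about every coefficient and
  requires \<open>m\<close> to be small.\<close>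

lemma discrete_ml_series:
  assumes m: "0 \<le> m" and r: "0 < r" "r < 1" and mr: "m < (1 - r) powr a"
  shows "(\<lambda>k. (- m) ^ k * fps_nth (fps_neg_binom (real k * a + 1)) n) sums fps_nth (discrete_ml a m) n"
proof -
  define t where "t n k = (- m) ^ k * fps_nth (fps_neg_binom (real k * a + 1)) n" for n k
  define q where "q = m * (1 - r) powr (- a)"
  have q: "0 \<le> q" "q < 1"
    using m mr r by (auto simp: q_def powr_minus field_simps)
  have bound: "norm (t n k) \<le> q ^ k / r ^ n" for n k
  proof -
    have "norm (t n k) = m ^ k * fps_nth (fps_neg_binom (real k * a + 1)) n"
      using m a by (simp add: t_def abs_mult power_abs fps_neg_binom_nonneg)
    also have "\<dots> \<le> m ^ k * ((1 - r) powr (- (real k * a)) / r ^ n)"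
      using fps_neg_binom_le_powr[of "real k * a" r n] r a m
      by (intro mult_left_mono) (auto simp: field_simps)
    also have "(1 - r) powr (- (real k * a)) = ((1 - r) powr (- a)) ^ k"
      using r by (simp add: powr_powr mult.commute flip: powr_realpow)
    finally show ?thesis by (simp add: q_def power_mult_distrib)
  qed
  have summ: "summable (t n)" for n
    using q by (intro summable_comparison_test'[OF _ bound] summable_divide summable_geometric) auto
  define V where "V = Abs_fps (\<lambda>n. suminf (t n))"
  have "(1 + fps_const m * fps_neg_binom a) * V = fps_neg_binom 1"
  proof (rule fps_ext)
    fix n
    have step: "m * (\<Sum>i\<le>n. fps_nth (fps_neg_binom a) i * t (n - i) k) = - t n (Suc k)" for k
    proof -
      have "(\<Sum>i\<le>n. fps_nth (fps_neg_binom a) i * t (n - i) k) =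
         (- m) ^ k * fps_nth (fps_neg_binom a * fps_neg_binom (real k * a + 1)) n"
        by (simp add: t_def fps_mult_nth atLeast0AtMost sum_distrib_left mult_ac)
      also have "fps_neg_binom a * fps_neg_binom (real k * a + 1) = fps_neg_binom (real (Suc k) * a + 1)"
        by (simp add: algebra_simps flip: fps_neg_binom_add)
      finally show ?thesis by (simp add: t_def)
    qed
    have "fps_nth (fps_neg_binom a * V) n = (\<Sum>i\<le>n. \<Sum>k. fps_nth (fps_neg_binom a) i * t (n - i) k)"
      by (simp add: fps_mult_nth atLeast0AtMost V_def suminf_mult summ)
    also have "\<dots> = (\<Sum>k. \<Sum>i\<le>n. fps_nth (fps_neg_binom a) i * t (n - i) k)"
      by (rule suminf_sum[symmetric]) (intro summable_mult summ)
    finally have "m * fps_nth (fps_neg_binom a * V) n = (\<Sum>k. m * (\<Sum>i\<le>n. fps_nth (fps_neg_binom a) i * t (n - i) k))"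
      by (simp add: suminf_mult summable_sum summable_mult summ)
    also have "\<dots> = - (\<Sum>k. t n (Suc k))"
      unfolding step using summ by (intro suminf_minus) (simp add: summable_Suc_iff)
    also have "\<dots> = t n 0 - suminf (t n)"
      using suminf_split_head[OF summ] by simp
    finally show "fps_nth ((1 + fps_const m * fps_neg_binom a) * V) n = fps_nth (fps_neg_binom 1) n"
      by (simp add: distrib_right mult.assoc V_def t_def)
  qed
  then have eq: "(1 + fps_const m * fps_neg_binom a) * V = (1 + fps_const m * fps_neg_binom a) * discrete_ml a m"
    by (simp add: discrete_ml_equation[OF m])
  have "fps_nth (1 + fps_const m * fps_neg_binom a) 0 \<noteq> 0"
    using m by (simp add: fps_neg_binom_nth)
  then have V: "V = discrete_ml a m"
    using eq by (metis mult_cancel_left fps_zero_nth)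
  then show ?thesis
    using summable_sums[OF summ[of n]] by (simp add: V_def t_def[abs_def] flip: V)
qed

text \<open>Euler's limit formula for the Gamma function.\<close>

lemma fps_neg_binom_asymp:
  assumes "0 \<le> b"
  shows "(\<lambda>n. fps_nth (fps_neg_binom (b + 1)) n * real n powr (- b)) \<longlonglongrightarrow> 1 / Gamma (b + 1)"
proof -
  have G: "Gamma (b + 1) \<noteq> 0" using Gamma_real_pos[of "b+1"] assms by linarith
  have "(\<lambda>n. inverse (Gamma_series' (b + 1) n)) \<longlonglongrightarrow> inverse (Gamma (b + 1))"
    by (intro tendsto_inverse Gamma_series'_LIMSEQ G)
  moreover have "\<forall>\<^sub>F n in sequentially. inverse (Gamma_series' (b + 1) n) =
      fps_nth (fps_neg_binom (b + 1)) n * real n powr (- b)"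
  proof (rule eventually_sequentiallyI[of 1])
    fix n :: nat assume n: "1 \<le> n"
    have "exp ((b + 1) * ln (real n)) = real n powr b * real n"
      using n by (simp add: powr_def distrib_right exp_add)
    moreover have "fact n = real n * fact (n - 1)" using n by (metis fact_reduce less_eq_Suc_le One_nat_def)
    ultimately show "inverse (Gamma_series' (b + 1) n) = fps_nth (fps_neg_binom (b + 1)) n * real n powr (- b)"
      using n by (simp add: Gamma_series'_def fps_neg_binom_nth powr_minus field_simps)
  qed
  ultimately show ?thesis
    by (simp add: tendsto_cong inverse_eq_divide)
qed

text \<open>Termwise, \<open>(- m)\<^sup>k (1 - z)\<^bsup>- k a - 1\<^esup>\<close> with \<open>m = x n powr (- a)\<close> has \<open>n\<close>-th coefficient tending to
  \<open>(- x)\<^sup>k / \<Gamma>(k a + 1)\<close>. Tannery's theorem allows to exchange this limit with the sum over \<open>k\<close>: the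
  radius \<open>1 - c / n\<close> in \<open>fps_neg_binom_le_powr\<close> gives the bound \<open>const \<cdot> (x / c\<^sup>a)\<^sup>k\<close> uniformly in \<open>n\<close>.\<close>

lemma discrete_ml_tendsto:
  assumes x: "0 \<le> x"
  shows "(\<lambda>n. fps_nth (discrete_ml a (x * real n powr (- a))) n) \<longlonglongrightarrow> mittag_leffler a 1 (- x)"
proof -
  \<comment> \<open>chosen such that \<open>x / c\<^sup>a \<le> 1 / 2\<close>, which makes the dominating series geometric\<close>
  define c where "c = (2 * x + 1) powr (1 / a)"
  have c: "0 < c" "c powr a = 2 * x + 1"
    using x a by (auto simp: c_def powr_powr)
  define g where "g n k = (- (x * real n powr (- a))) ^ k * fps_nth (fps_neg_binom (real k * a + 1)) n" for n k
  define n0 where "n0 = nat \<lceil>2 * c\<rceil> + 1"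
  have n0: "0 < real n" "2 * c \<le> real n" if "n \<ge> n0" for n
    using that c(1) unfolding n0_def by linarith+
  have rho: "0 < 1 - c / n" "1 - c / n < 1" "1/2 \<le> 1 - c / n" if "n \<ge> n0" for n
    using n0[OF that] c(1) by (auto simp: field_simps)
  have key: "x * real n powr (- a) = x / (2 * x + 1) * (c / n) powr a" if "n \<ge> n0" for n
  proof -
    have "(c / n) powr a = (2 * x + 1) * real n powr (- a)"
      unfolding powr_divide powr_minus c(2) by (rule divide_inverse)
    then show ?thesis using x by simp
  qed
  have rho_pow: "exp (- (2 * c)) \<le> (1 - c / n) ^ n" if "n \<ge> n0" for n
  proof -
    define y where "y = c / n"
    have y: "0 \<le> y" "y \<le> 1 / 2" using rho(2,3)[OF that] by (auto simp: y_def)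
    have "2 * y\<^sup>2 \<le> y" using y mult_right_mono[OF y(2) y(1)] by (simp add: power2_eq_square)
    then have "- (2 * y) \<le> ln (1 - y)"
      using ln_one_minus_pos_lower_bound[OF y] by linarith
    then have "exp (- (2 * y)) \<le> 1 - y"
      using y by (subst (asm) ln_ge_iff) auto
    then have "exp (- (2 * y)) ^ n \<le> (1 - y) ^ n" by (intro power_mono) auto
    moreover have "exp (- (2 * y)) ^ n = exp (- (2 * c))"
      using n0(1)[OF that] by (simp add: y_def flip: exp_of_nat_mult)
    ultimately show ?thesis by (simp add: y_def)
  qed
  have lim: "(\<lambda>n. suminf (g n)) \<longlonglongrightarrow> (\<Sum>k. (- x) ^ k /\<^sub>R Gamma (real k * a + 1))"
  proof (rule tannerys_theorem[THEN conjunct2, THEN conjunct2])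
    show "(\<lambda>n. g n k) \<longlonglongrightarrow> (- x) ^ k /\<^sub>R Gamma (real k * a + 1)" for k
    proof -
      have lim: "(\<lambda>n. (- x) ^ k * (fps_nth (fps_neg_binom (real k * a + 1)) n * real n powr (- (real k * a))))
          \<longlonglongrightarrow> (- x) ^ k * (1 / Gamma (real k * a + 1))"
        using a by (intro tendsto_mult tendsto_const fps_neg_binom_asymp) auto
      have eq: "(- x) ^ k * (fps_nth (fps_neg_binom (real k * a + 1)) n * real n powr (- (real k * a))) = g n k"
        if "n > 0" for n
      proof -
        have "real n powr (- (real k * a)) = (real n powr (- a)) ^ k"
          using that by (simp add: powr_powr mult.commute flip: powr_realpow)
        moreover have "(- (x * real n powr (- a))) ^ k = (- x) ^ k * (real n powr (- a)) ^ k"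
          by (metis mult_minus_left power_mult_distrib)
        ultimately show ?thesis unfolding g_def
          by (simp only: mult_ac)
      qed
      have "(\<lambda>n. g n k) \<longlonglongrightarrow> (- x) ^ k * (1 / Gamma (real k * a + 1))"
        using lim by (rule Lim_transform_eventually)
          (rule eventually_sequentiallyI[of 1], rule eq, simp)
      then show ?thesis by (simp only: real_scaleR_def divide_inverse mult_1 mult.commute)
    qed
    show "eventually (\<lambda>(k, n). norm (g n k) \<le> exp (2 * c) * (1/2) ^ k) (at_top \<times>\<^sub>F sequentially)"
    proof -
      have bound: "norm (g n k) \<le> exp (2 * c) * (1/2) ^ k" if n: "n0 \<le> n" for n k
      proof -
        let ?r = "1 - c / n" and ?b = "fps_nth (fps_neg_binom (real k * a + 1)) n"
        have b0: "0 \<le> ?b" using a by (intro fps_neg_binom_nonneg) auto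
        have "?b * exp (- (2 * c)) \<le> ?b * ?r ^ n"
          using rho_pow[OF n] b0 by (intro mult_left_mono) auto
        also have "\<dots> \<le> (c / n) powr (- (real k * a))"
          using fps_neg_binom_le_powr[of "real k * a" ?r n] rho[OF n] a by simp
        also have "\<dots> = inverse (((c / n) powr a) ^ k)"
          using n0[OF n] c by (simp add: powr_minus powr_powr mult.commute flip: powr_realpow)
        finally have b: "?b \<le> exp (2 * c) * inverse (((c / n) powr a) ^ k)"
          by (simp add: exp_minus field_simps)
        have "norm (g n k) = (x / (2 * x + 1) * (c / n) powr a) ^ k * ?b"
          using x b0 by (simp add: g_def abs_mult power_abs key[OF n])
        also have "\<dots> \<le> (x / (2 * x + 1) * (c / n) powr a) ^ k * (exp (2 * c) * inverse (((c / n) powr a) ^ k))"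
          using b x by (intro mult_left_mono) auto
        also have "\<dots> = exp (2 * c) * (x / (2 * x + 1)) ^ k"
        proof -
          have "(c / n) powr a \<noteq> 0" using n0[OF n] c(1) by simp
          then show ?thesis unfolding power_mult_distrib by simp
        qed
        also have "\<dots> \<le> exp (2 * c) * (1/2) ^ k"
          using x by (intro mult_left_mono power_mono) (auto simp: field_simps)
        finally show ?thesis .
      qed
      have "eventually (\<lambda>p. True \<and> n0 \<le> snd p) (at_top \<times>\<^sub>F sequentially)"
        by (rule eventually_prodI[OF always_eventually eventually_ge_at_top]) simp
      then show ?thesis by (rule eventually_mono) (auto simp: bound simp del: real_norm_def)
    qed
    show "summable (\<lambda>k. exp (2 * c) * (1/2 :: real) ^ k)"
      by (intro summable_mult summable_geometric) simp
  qed simp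
  have "\<forall>\<^sub>F n in sequentially. suminf (g n) = fps_nth (discrete_ml a (x * real n powr (- a))) n"
  proof (rule eventually_sequentiallyI[of n0])
    fix n assume n: "n0 \<le> n"
    have "x * real n powr (- a) < (1 - (1 - c / n)) powr a"
    proof -
      have "x / (2 * x + 1) * (c / n) powr a < 1 * (c / n) powr a"
        using n0[OF n] x c(1) by (intro mult_strict_right_mono) auto
      then show ?thesis by (simp add: key[OF n])
    qed
    from discrete_ml_series[OF _ rho(1,2)[OF n] this, of n] x
    show "suminf (g n) = fps_nth (discrete_ml a (x * real n powr (- a))) n"
      by (simp add: g_def[abs_def] sums_iff)
  qed
  with lim show ?thesis
    by (simp add: mittag_leffler_def Lim_transform_eventually)
qed

lemma mittag_leffler_nonneg:
  fixes x :: real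
  shows "0 \<le> x \<Longrightarrow> 0 \<le> mittag_leffler a 1 (- x)"
  by (rule LIMSEQ_le_const[OF discrete_ml_tendsto]) (auto intro!: discrete_ml_nonneg)

lemma mittag_leffler_antimono:
  fixes x y :: real
  assumes "0 \<le> x" "x \<le> y"
  shows "mittag_leffler a 1 (- y) \<le> mittag_leffler a 1 (- x)"
  by (rule LIMSEQ_le[OF discrete_ml_tendsto discrete_ml_tendsto])
    (use assms in \<open>auto intro!: discrete_ml_antimono mult_right_mono\<close>)

lemma mittag_leffler_decay:
  assumes x: "0 \<le> x"
  shows "mittag_leffler a 1 (- x) * (1 + x / Gamma (a + 1)) \<le> 1"
proof (rule LIMSEQ_le_const2)
  show "(\<lambda>n. fps_nth (discrete_ml a (x * real n powr (- a))) n *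
          (1 + x * (fps_nth (fps_neg_binom (a + 1)) n * real n powr (- a))))
     \<longlonglongrightarrow> mittag_leffler a 1 (- x) * (1 + x / Gamma (a + 1))"
    using tendsto_mult[OF discrete_ml_tendsto[OF x]
        tendsto_add[OF tendsto_const[of 1] tendsto_mult[OF tendsto_const[of x] fps_neg_binom_asymp[of a]]]] a
    by simp
  show "\<exists>N. \<forall>n\<ge>N. fps_nth (discrete_ml a (x * real n powr (- a))) n *
          (1 + x * (fps_nth (fps_neg_binom (a + 1)) n * real n powr (- a))) \<le> 1"
    using discrete_ml_bound[of "x * real n powr (- a)" n for n] x by (auto simp: mult_ac)
qed

end

text \<open>A number in \<open>[0, 1]\<close> is at most its \<open>\<sigma>\<close>-th power, and \<open>E\<^sub>a(-x)\<close> is bounded both by \<open>1\<close> and by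
  \<open>\<Gamma>(a + 1) / x\<close>.\<close>

lemma mittag_leffler_powr_bound:
  fixes x :: real
  assumes a: "0 < a" "a < 1" and \<sigma>: "0 \<le> \<sigma>" "\<sigma> \<le> 1" and x: "0 < x"
  shows "mittag_leffler a 1 (- x) \<le> Gamma (a + 1) powr \<sigma> * x powr (- \<sigma>)"
proof -
  define E g where "E = mittag_leffler a 1 (- x)" and "g = Gamma (a + 1)"
  have g: "0 < g" using a by (simp add: g_def Gamma_real_pos)
  have E0: "0 \<le> E" unfolding E_def using x by (intro mittag_leffler_nonneg[OF a]) simp
  have "E * (1 + x / g) \<le> 1"
    unfolding E_def g_def using x by (intro mittag_leffler_decay[OF a]) simp
  then have sum: "E + E * (x / g) \<le> 1" by (simp add: distrib_left)
  have "0 \<le> E * (x / g)" using E0 x g by simp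
  then have E1: "E \<le> 1" using sum by linarith
  have "E * (x / g) \<le> 1" using sum E0 by linarith
  then have Eg: "E \<le> g / x" using x g by (simp add: field_simps)
  have "E \<le> E powr \<sigma>"
  proof (cases "E = 0")
    case False
    then have "E powr 1 \<le> E powr \<sigma>" using E0 E1 \<sigma> by (intro powr_mono') auto
    then show ?thesis using E0 by simp
  qed simp
  also have "\<dots> \<le> (g / x) powr \<sigma>" using Eg E0 \<sigma> by (intro powr_mono2) auto
  also have "\<dots> = g powr \<sigma> * x powr (- \<sigma>)"
    unfolding powr_divide powr_minus by (rule divide_inverse)
  finally show ?thesis by (simp add: E_def g_def)
qed

text \<open>The solution \<open>\<tau> \<mapsto> E\<^sub>\<alpha>(- \<mu> \<tau>\<^sup>\<alpha>)\<close> of the fractional relaxation equation with rate \<open>\<mu>\<close>.\<close>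

definition relaxation :: "real \<Rightarrow> real \<Rightarrow> real \<Rightarrow> real" where
  "relaxation \<alpha> \<mu> \<tau> = mittag_leffler \<alpha> 1 (- \<mu> * \<tau> powr \<alpha>)"

context
  fixes \<alpha> \<mu> :: real
  assumes \<alpha>: "0 < \<alpha>" "\<alpha> < 1" and \<mu>: "0 < \<mu>"
begin

lemma relaxation_nonneg: "0 \<le> relaxation \<alpha> \<mu> \<tau>"
  unfolding relaxation_def using mittag_leffler_nonneg[OF \<alpha>, of "\<mu> * \<tau> powr \<alpha>"] \<mu> by simp

lemma relaxation_antimono: "0 \<le> \<tau> \<Longrightarrow> \<tau> \<le> \<tau>' \<Longrightarrow> relaxation \<alpha> \<mu> \<tau>' \<le> relaxation \<alpha> \<mu> \<tau>"
  unfolding relaxation_def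
  using mittag_leffler_antimono[OF \<alpha>, of "\<mu> * \<tau> powr \<alpha>" "\<mu> * \<tau>' powr \<alpha>"] \<mu> \<alpha> by (simp add: powr_mono2)

lemma relaxation_decay:
  assumes \<sigma>: "0 \<le> \<sigma>" "\<sigma> \<le> 1" and \<tau>: "0 < \<tau>"
  shows "relaxation \<alpha> \<mu> \<tau> \<le> Gamma (\<alpha> + 1) powr \<sigma> * \<mu> powr (- \<sigma>) * \<tau> powr (- (\<alpha> * \<sigma>))"
proof -
  have "relaxation \<alpha> \<mu> \<tau> \<le> Gamma (\<alpha> + 1) powr \<sigma> * (\<mu> * \<tau> powr \<alpha>) powr (- \<sigma>)"
    unfolding relaxation_def
    using mittag_leffler_powr_bound[OF \<alpha> \<sigma>, of "\<mu> * \<tau> powr \<alpha>"] \<mu> \<tau> by simp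
  also have "(\<mu> * \<tau> powr \<alpha>) powr (- \<sigma>) = \<mu> powr (- \<sigma>) * \<tau> powr (- (\<alpha> * \<sigma>))"
    unfolding powr_mult powr_powr by simp
  finally show ?thesis by (simp only: mult.assoc)
qed

end

section \<open>Fractional Brownian motion and uniqueness of the Wiener integral\<close>

text \<open>This cannot be inferred from the covariance formula alone, because the integral of a
  nonintegrable function is \<open>0\<close>, which is also the prescribed second moment at time \<open>0\<close>.\<close>

lemma gaussian_rv_L2:
  assumes "prob_space M" and g: "gaussian_rv M X"
  shows "L2 M X"
proof -
  interpret prob_space M by fact
  have [measurable]: "X \<in> borel_measurable M" using g by (simp add: gaussian_rv_def)
  have const: "L2 M (\<lambda>_. c::real)" for c by (simp add: L2_def)
  consider (normal) \<mu> \<sigma> where "0 < \<sigma>" "distributed M lborel X (\<lambda>x. ennreal (normal_density \<mu> \<sigma> x))"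
    | (deg) c where "AE \<omega> in M. X \<omega> = c"
    using g by (auto simp: gaussian_rv_def)
  then show ?thesis
  proof cases
    case normal
    have "integrable M (\<lambda>\<omega>. (X \<omega> - \<mu>)\<^sup>2)"
      using integrable_normal_moment[OF normal(1), of \<mu> 2] distributed_integrable[OF normal(2), of "\<lambda>x. (x - \<mu>)\<^sup>2"]
      by simp
    then have "L2 M (\<lambda>\<omega>. X \<omega> - \<mu>)" by (simp add: L2_def)
    from L2_add[OF this const[of \<mu>]] show ?thesis by simp
  next
    case deg
    have "integrable M (\<lambda>\<omega>. (X \<omega>)\<^sup>2) \<longleftrightarrow> integrable M (\<lambda>\<omega>. c\<^sup>2)"
      by (rule integrable_cong_AE) (use deg in auto)
    then show ?thesis by (simp add: L2_def)
  qed
qed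

lemma step_integral_Nil: "step_integral W [] = (\<lambda>\<omega>. 0)"
  by (simp add: step_integral_def fun_eq_iff)

lemma step_integral_Cons:
  "step_integral W ((a, u, v) # S) = (\<lambda>\<omega>. a * (W v \<omega> - W u \<omega>) + step_integral W S \<omega>)"
  by (simp add: step_integral_def fun_eq_iff)

lemma step_fun_Nil: "step_fun [] = (\<lambda>r. 0)"
  by (simp add: step_fun_def fun_eq_iff)

lemma step_fun_Cons: "step_fun ((a, u, v) # S) = (\<lambda>r. a * indicator {u<..v} r + step_fun S r)"
  by (simp add: step_fun_def fun_eq_iff)

text \<open>A list that encodes the difference of two step functions.\<close>

definition step_diff :: "(real \<times> real \<times> real) list \<Rightarrow> (real \<times> real \<times> real) list \<Rightarrow> (real \<times> real \<times> real) list" where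
  "step_diff S S' = S @ map (\<lambda>(a, u, v). (- a, u, v)) S'"

lemma step_fun_diff: "step_fun (step_diff S S') r = step_fun S r - step_fun S' r"
proof -
  have "step_fun (map (\<lambda>(a, u, v). (- a, u, v)) S') r = - step_fun S' r"
    by (induction S') (auto simp: step_fun_Nil step_fun_Cons)
  then show ?thesis by (simp add: step_diff_def step_fun_def)
qed

lemma step_integral_diff: "step_integral W (step_diff S S') \<omega> = step_integral W S \<omega> - step_integral W S' \<omega>"
proof -
  have "step_integral W (map (\<lambda>(a, u, v). (- a, u, v)) S') \<omega> = - step_integral W S' \<omega>"
    by (induction S') (auto simp: step_integral_Nil step_integral_Cons algebra_simps)
  then show ?thesis by (simp add: step_diff_def step_integral_def)
qed

lemma L2_lebesgue_on_bounded:
  fixes f :: "real \<Rightarrow> real"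
  assumes "f \<in> borel_measurable (lebesgue_on {0..t})" "\<And>r. r \<in> {0..t} \<Longrightarrow> \<bar>f r\<bar> \<le> B"
  shows "L2 (lebesgue_on {0..t}) f"
proof -
  interpret finite_measure "lebesgue_on {0..t}" by (rule finite_measure_lebesgue_on) simp
  have "integrable (lebesgue_on {0..t}) (\<lambda>r. (norm (f r))\<^sup>2)"
  proof (rule integrable_const_bound)
    show "AE r in lebesgue_on {0..t}. norm ((norm (f r))\<^sup>2) \<le> B\<^sup>2"
    proof (rule AE_I2)
      fix r assume "r \<in> space (lebesgue_on {0..t})"
      then have "norm (f r) \<le> B" using assms(2) by simp
      then have "(norm (f r))\<^sup>2 \<le> B\<^sup>2" by (rule power_mono) simp
      then show "norm ((norm (f r))\<^sup>2) \<le> B\<^sup>2" by simp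
    qed
    show "(\<lambda>r. (norm (f r))\<^sup>2) \<in> borel_measurable (lebesgue_on {0..t})"
      using assms(1) by measurable
  qed
  then show ?thesis using assms(1) by (simp add: L2_def)
qed

lemma step_fun_L2: "L2 (lebesgue_on {0..t}) (step_fun S)"
proof -
  have "L2 (lebesgue_on {0..t}) (\<lambda>r. indicator {u<..v} r :: real)" for u v :: real
    by (rule L2_lebesgue_on_bounded[where B = 1])
      (auto intro!: borel_imp_lebesgue_on split: split_indicator)
  then show ?thesis
    by (induction S) (auto simp: step_fun_Nil step_fun_Cons L2_zero intro!: L2_add L2_cmult)
qed

text \<open>Sums of increments of a \<open>C\<^sup>1\<close> function are integrals of the step function against its derivative;
  in particular they are continuous in the \<open>L\<^sup>2\<close> norm of the step function.\<close>

lemma integral_step_fun_mult: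
  assumes S: "\<forall>(a, u, v)\<in>set S. 0 \<le> u \<and> u \<le> v \<and> v \<le> t"
    and K: "\<And>r. (K has_real_derivative k r) (at r)" and k: "continuous_on UNIV k"
  shows "(\<integral>r. step_fun S r * k r \<partial>lebesgue_on {0..t}) = (\<Sum>(a, u, v)\<leftarrow>S. a * (K v - K u))"
proof -
  have kb: "k \<in> borel_measurable borel" using k by (rule borel_measurable_continuous_onI)
  obtain B where B: "\<And>r. r \<in> {0..t} \<Longrightarrow> \<bar>k r\<bar> \<le> B"
  proof -
    have "compact (k ` {0..t})"
      by (rule compact_continuous_image) (use k in \<open>auto intro: continuous_on_subset\<close>)
    then have "bounded (k ` {0..t})" by (rule compact_imp_bounded)
    then obtain B where "\<forall>r\<in>{0..t}. \<bar>k r\<bar> \<le> B" by (auto simp: bounded_iff)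
    then show ?thesis by (intro that[of B]) blast
  qed
  have Lk: "L2 (lebesgue_on {0..t}) k"
    by (rule L2_lebesgue_on_bounded[OF borel_imp_lebesgue_on[OF kb] B])
  have single: "(\<integral>r. indicator {u<..v} r * k r \<partial>lebesgue_on {0..t}) = K v - K u"
    if "0 \<le> u" "u \<le> v" "v \<le> t" for u v
  proof -
    have "(\<integral>r. indicator {u<..v} r * k r \<partial>lebesgue_on {0..t})
        = (\<integral>r. indicator {0..t} r * (indicator {u<..v} r * k r) \<partial>lborel)"
      using kb by (intro integral_lebesgue_on_borel) measurable
    also have "\<dots> = (\<integral>r. indicator {u<..v} r * k r \<partial>lborel)"
      using that by (intro Bochner_Integration.integral_cong refl) (auto split: split_indicator)
    also have "\<dots> = (\<integral>r. k r * indicator {u..v} r \<partial>lborel)"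
    proof (rule integral_cong_AE)
      show "AE r in lborel. indicator {u<..v} r * k r = k r * indicator {u..v} r"
        using AE_lborel_singleton[of u] by eventually_elim (auto split: split_indicator)
    qed (use kb in measurable)
    also have "\<dots> = K v - K u"
      using that K k by (intro integral_FTC_Icc_real) (auto simp: continuous_on_eq_continuous_at)
    finally show ?thesis .
  qed
  have int1: "integrable (lebesgue_on {0..t}) (\<lambda>r. indicator {u<..v} r * k r)" for u v
    using L2_mult_integrable[OF step_fun_L2[of t "[(1, u, v)]"] Lk]
    by (simp add: step_fun_Cons step_fun_Nil)
  have int2: "integrable (lebesgue_on {0..t}) (\<lambda>r. step_fun S r * k r)" for S
    by (rule L2_mult_integrable[OF step_fun_L2 Lk])
  show ?thesis using S
  proof (induction S)
    case (Cons p S)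
    obtain a u v where p: "p = (a, u, v)" by (cases p)
    have "(\<integral>r. step_fun (p # S) r * k r \<partial>lebesgue_on {0..t}) =
        (\<integral>r. a * (indicator {u<..v} r * k r) + step_fun S r * k r \<partial>lebesgue_on {0..t})"
      by (simp add: p step_fun_Cons algebra_simps)
    also have "\<dots> = a * (K v - K u) + (\<integral>r. step_fun S r * k r \<partial>lebesgue_on {0..t})"
      using Cons.prems p by (simp add: int1 int2 single)
    finally show ?case using Cons by (simp add: p)
  qed (simp add: step_fun_Nil)
qed

lemma abs_powr_antiderivative:
  fixes p :: real
  assumes p: "0 < p"
  shows "((\<lambda>y. y * \<bar>y\<bar> powr p / (p + 1)) has_real_derivative \<bar>y\<bar> powr p) (at y)"
proof -
  consider "0 < y" | "y < 0" | "y = 0" by linarith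
  then show ?thesis
  proof cases
    case 1
    have D: "((\<lambda>y. y * y powr p / (p + 1)) has_real_derivative \<bar>y\<bar> powr p) (at y)"
    proof -
      have "((\<lambda>y. y * y powr p / (p + 1)) has_real_derivative
          (1 * y powr p + (p * y powr (p - 1)) * y) / (p + 1)) (at y)"
        using 1 by (intro DERIV_cdivide DERIV_mult has_real_derivative_powr DERIV_ident)
      moreover have "y powr (p - 1) * y = y powr p"
        using 1 by (simp add: powr_diff)
      then have "(1 * y powr p + (p * y powr (p - 1)) * y) / (p + 1) = y powr p"
        using p by (simp add: mult.assoc) (simp add: field_simps)
      ultimately show ?thesis using 1 by simp
    qed
    show ?thesis
      by (rule has_field_derivative_transform_within_open[OF D, of "{0<..}"]) (use 1 in simp_all)
  next
    case 2
    have D: "((\<lambda>y. y * (- y) powr p / (p + 1)) has_real_derivative \<bar>y\<bar> powr p) (at y)"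
    proof -
      have "((\<lambda>y. (- y) powr p) has_real_derivative p * (- y) powr (p - 1) * (- 1)) (at y)"
        using 2 by (intro DERIV_fun_powr[where g = uminus and r = p, THEN DERIV_cong]) (auto intro!: derivative_eq_intros)
      then have "((\<lambda>y. y * (- y) powr p / (p + 1)) has_real_derivative
          (1 * (- y) powr p + (p * (- y) powr (p - 1) * (- 1)) * y) / (p + 1)) (at y)"
        using 2 by (intro DERIV_cdivide DERIV_mult DERIV_ident)
      moreover have "(- y) powr (p - 1) * y = - ((- y) powr p)"
        using 2 by (simp add: powr_diff)
      then have "(1 * (- y) powr p + (p * (- y) powr (p - 1) * (- 1)) * y) / (p + 1) = (- y) powr p"
        using p by (simp add: mult.assoc) (simp add: field_simps)
      ultimately show ?thesis using 2 by simp
    qed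
    show ?thesis
      by (rule has_field_derivative_transform_within_open[OF D, of "{..<0}"]) (use 2 in simp_all)
  next
    case 3
    have "((\<lambda>h. \<bar>h\<bar> powr p / (p + 1)) \<longlongrightarrow> \<bar>0\<bar> powr p / (p + 1)) (at (0::real))"
      using p by (intro tendsto_intros) auto
    then have "((\<lambda>h. \<bar>h\<bar> powr p / (p + 1)) \<longlongrightarrow> 0) (at (0::real))" by simp
    moreover have "\<forall>\<^sub>F h in at (0::real). \<bar>h\<bar> powr p / (p + 1) =
        ((0 + h) * \<bar>0 + h\<bar> powr p / (p + 1) - 0 * \<bar>0\<bar> powr p / (p + 1)) / h"
      by (simp add: eventually_at_filter)
    ultimately have "((\<lambda>h. ((0 + h) * \<bar>0 + h\<bar> powr p / (p + 1) - 0 * \<bar>0\<bar> powr p / (p + 1)) / h) \<longlongrightarrow> 0) (at (0::real))"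
      by (rule Lim_transform_eventually)
    then show ?thesis using 3 p by (simp add: DERIV_def)
  qed
qed

context
  fixes M :: "'w measure" and W :: "real \<Rightarrow> 'w \<Rightarrow> real" and H :: real
  assumes M: "prob_space M" and fbm: "fractional_brownian_motion M H W" and H: "0 < H"
begin

lemma fbm_L2: "0 \<le> t \<Longrightarrow> L2 M (W t)"
proof -
  assume t: "0 \<le> t"
  have "gaussian_rv M (\<lambda>\<omega>. \<Sum>t\<in>{t}. 1 * W t \<omega>)"
    using fbm t unfolding fractional_brownian_motion_def gaussian_process_def
    by (elim conjE allE[of _ "{t}"] allE[of _ "\<lambda>_. 1"]) simp
  then show ?thesis using gaussian_rv_L2[OF M, of "W t"] by simp
qed

lemma fbm_covariance:
  "0 \<le> t \<Longrightarrow> 0 \<le> r \<Longrightarrow> (\<integral>\<omega>. W t \<omega> * W r \<omega> \<partial>M) =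
     (t powr (2 * H) + r powr (2 * H) - \<bar>t - r\<bar> powr (2 * H)) / 2"
  using fbm by (simp add: fractional_brownian_motion_def)

lemma fbm_increment:
  assumes u: "0 \<le> u" and v: "0 \<le> v"
  shows "L2_norm M (\<lambda>\<omega>. W v \<omega> - W u \<omega>) = \<bar>v - u\<bar> powr H"
proof -
  note int = L2_mult_integrable[OF fbm_L2 fbm_L2]
  have "(\<integral>\<omega>. (W v \<omega> - W u \<omega>)\<^sup>2 \<partial>M) =
      (\<integral>\<omega>. W v \<omega> * W v \<omega> - 2 * (W v \<omega> * W u \<omega>) + W u \<omega> * W u \<omega> \<partial>M)"
    by (intro Bochner_Integration.integral_cong refl) (simp add: power2_eq_square algebra_simps)
  also have "\<dots> = \<bar>v - u\<bar> powr (2 * H)"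
    using int u v by (simp add: fbm_covariance abs_minus_commute[of u v] field_simps)
  also have "\<dots> = (\<bar>v - u\<bar> powr H)\<^sup>2"
    by (simp add: power2_eq_square flip: powr_add)
  finally show ?thesis by (simp add: L2_norm_def)
qed

lemma fbm_norm:
  assumes "0 \<le> t"
  shows "L2_norm M (W t) = t powr H"
proof -
  have "(\<integral>\<omega>. (W t \<omega>)\<^sup>2 \<partial>M) = t powr (2 * H)"
    using fbm_covariance[OF assms assms] by (simp add: power2_eq_square)
  also have "\<dots> = (t powr H)\<^sup>2"
    by (simp add: power2_eq_square flip: powr_add)
  finally show ?thesis by (simp add: L2_norm_def)
qed

lemma step_integral_L2:
  assumes "\<forall>(a, u, v)\<in>set S. 0 \<le> u \<and> u \<le> v \<and> v \<le> t"
  shows "L2 M (step_integral W S)"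
  using assms
proof (induction S)
  case (Cons p S)
  obtain a u v where p: "p = (a, u, v)" by (cases p)
  show ?case using Cons unfolding p step_integral_Cons
    by (intro L2_add L2_cmult L2_diff fbm_L2) auto
qed (simp add: step_integral_Nil L2_zero)

lemma integral_step_integral_mult:
  assumes S: "\<forall>(a, u, v)\<in>set S. 0 \<le> u \<and> u \<le> v \<and> v \<le> t" and Y: "L2 M Y"
  shows "(\<integral>\<omega>. step_integral W S \<omega> * Y \<omega> \<partial>M) =
    (\<Sum>(a, u, v)\<leftarrow>S. a * ((\<integral>\<omega>. W v \<omega> * Y \<omega> \<partial>M) - (\<integral>\<omega>. W u \<omega> * Y \<omega> \<partial>M)))"
  using S
proof (induction S)
  case (Cons p S)
  obtain a u v where p: "p = (a, u, v)" by (cases p)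
  have uv: "0 \<le> u" "0 \<le> v" using Cons.prems p by auto
  have [simp]: "integrable M (\<lambda>\<omega>. W v \<omega> * Y \<omega>)" "integrable M (\<lambda>\<omega>. W u \<omega> * Y \<omega>)"
    using uv by (auto intro!: L2_mult_integrable fbm_L2 Y)
  have [simp]: "integrable M (\<lambda>\<omega>. step_integral W S \<omega> * Y \<omega>)"
    using Cons.prems by (intro L2_mult_integrable step_integral_L2 Y) auto
  have "(\<integral>\<omega>. step_integral W (p # S) \<omega> * Y \<omega> \<partial>M) =
     (\<integral>\<omega>. a * (W v \<omega> * Y \<omega> - W u \<omega> * Y \<omega>) + step_integral W S \<omega> * Y \<omega> \<partial>M)"
    by (simp add: p step_integral_Cons algebra_simps)
  also have "\<dots> = a * ((\<integral>\<omega>. W v \<omega> * Y \<omega> \<partial>M) - (\<integral>\<omega>. W u \<omega> * Y \<omega> \<partial>M))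
      + (\<integral>\<omega>. step_integral W S \<omega> * Y \<omega> \<partial>M)"
    by simp
  finally show ?case using Cons by (simp add: p)
qed (simp add: step_integral_Nil)


text \<open>The limit \<open>Y\<close> lies in the closed span of the variables \<open>W(s)\<close>, so it suffices to show that
  \<open>F(s) = E[Y W(s)]\<close> vanishes. It is the uniform limit of \<open>F\<^sub>n(s) = E[I\<^sub>n W(s)]\<close>, where \<open>I\<^sub>n\<close> is the
  integral of the \<open>n\<close>-th step function \<open>S\<^sub>n\<close>. As a functional of \<open>S\<^sub>n\<close>, \<open>F\<^sub>n(s)\<close> need not be continuous in
  \<open>L\<^sup>2\<close>, because the derivative of the covariance in one variable has singularities that are not square
  integrable when \<open>H\<close> is small. The term \<open>r\<^sup>2\<^sup>H\<close> of the covariance contributes a constant \<open>c\<^sub>n\<close> to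
  \<open>F\<^sub>n\<close>, independent of \<open>s\<close>. The singularity of the term \<open>|r - s|\<^sup>2\<^sup>H\<close> at \<open>r = s\<close> disappears after
  integration over \<open>s \<in> [0, b]\<close>: the resulting function \<open>\<kappa>\<^sub>b\<close> of \<open>r\<close> is \<open>C\<^sup>1\<close>, so its contribution \<open>d\<^sub>n(b)\<close>
  tends to zero with \<open>S\<^sub>n\<close>. Hence the integral of \<open>F\<close> over \<open>[0, b]\<close> is \<open>C b\<close> for all \<open>b\<close>, so \<open>F\<close> is
  constant, and \<open>F(0) = 0\<close>.\<close>

lemma step_integral_closable:
  assumes t: "0 < t"
    and S: "\<And>n. \<forall>(a, u, v)\<in>set (S n). 0 \<le> u \<and> u \<le> v \<and> v \<le> t"
    and null: "(\<lambda>n. L2_norm (lebesgue_on {0..t}) (step_fun (S n))) \<longlonglongrightarrow> 0"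
    and conv: "L2_converges M (\<lambda>n. step_integral W (S n)) Y"
  shows "L2_norm M Y = 0"
proof -
  define p where "p = 2 * H"
  have p: "0 < p" using H by (simp add: p_def)
  have Y: "L2 M Y" using conv by (simp add: L2_converges_def)
  define F where "F s = (\<integral>\<omega>. W s \<omega> * Y \<omega> \<partial>M)" for s
  define Fn where "Fn n s = (\<integral>\<omega>. step_integral W (S n) \<omega> * W s \<omega> \<partial>M)" for n s
  define \<epsilon> where "\<epsilon> n = L2_norm M (\<lambda>\<omega>. step_integral W (S n) \<omega> - Y \<omega>)" for n
  have \<epsilon>: "\<epsilon> \<longlonglongrightarrow> 0" using conv by (simp add: L2_converges_def \<epsilon>_def[abs_def])
  have LS: "L2 M (step_integral W (S n))" for n by (rule step_integral_L2[OF S])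
  have close: "\<bar>Fn n s - F s\<bar> \<le> \<epsilon> n * t powr H" if s: "s \<in> {0..t}" for n s
  proof -
    have Ws: "L2 M (W s)" using s by (intro fbm_L2) simp
    have "Fn n s - F s = (\<integral>\<omega>. step_integral W (S n) \<omega> * W s \<omega> - W s \<omega> * Y \<omega> \<partial>M)"
      unfolding Fn_def F_def
      by (rule Bochner_Integration.integral_diff[symmetric]) (intro L2_mult_integrable LS Ws Y)+
    also have "\<dots> = (\<integral>\<omega>. (step_integral W (S n) \<omega> - Y \<omega>) * W s \<omega> \<partial>M)"
      by (simp add: algebra_simps)
    also have "\<bar>\<dots>\<bar> \<le> \<epsilon> n * L2_norm M (W s)"
      unfolding \<epsilon>_def by (intro L2_Cauchy_Schwarz L2_diff LS Y Ws)
    also have "\<dots> \<le> \<epsilon> n * t powr H"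
      using s H by (intro mult_left_mono) (auto simp: fbm_norm \<epsilon>_def L2_norm_nonneg powr_mono2)
    finally show ?thesis .
  qed
  have cont: "continuous_on {0..t} F"
    unfolding continuous_on_def
  proof
    fix s assume s: "s \<in> {0..t}"
    have bound: "norm (F r - F s) \<le> \<bar>r - s\<bar> powr H * L2_norm M Y" if r: "r \<in> {0..t}" for r
    proof -
      have L: "L2 M (W s)" "L2 M (W r)" using s r by (auto intro: fbm_L2)
      have "F r - F s = (\<integral>\<omega>. W r \<omega> * Y \<omega> - W s \<omega> * Y \<omega> \<partial>M)"
        unfolding F_def
        by (rule Bochner_Integration.integral_diff[symmetric]) (intro L2_mult_integrable L Y)+
      also have "\<dots> = (\<integral>\<omega>. (W r \<omega> - W s \<omega>) * Y \<omega> \<partial>M)"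
        by (simp add: algebra_simps)
      also have "norm \<dots> \<le> L2_norm M (\<lambda>\<omega>. W r \<omega> - W s \<omega>) * L2_norm M Y"
        unfolding real_norm_def by (intro L2_Cauchy_Schwarz L2_diff L Y)
      finally show ?thesis using s r by (simp add: fbm_increment)
    qed
    have "((\<lambda>r. \<bar>r - s\<bar> powr H * L2_norm M Y) \<longlongrightarrow> \<bar>s - s\<bar> powr H * L2_norm M Y) (at s within {0..t})"
      using H by (intro tendsto_intros) auto
    then have lim: "((\<lambda>r. \<bar>r - s\<bar> powr H * L2_norm M Y) \<longlongrightarrow> 0) (at s within {0..t})" by simp
    have "((\<lambda>r. F r - F s) \<longlongrightarrow> 0) (at s within {0..t})"
    proof (rule Lim_null_comparison[OF _ lim])
      show "\<forall>\<^sub>F r in at s within {0..t}. norm (F r - F s) \<le> \<bar>r - s\<bar> powr H * L2_norm M Y"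
        unfolding eventually_at_filter using bound by (intro always_eventually allI impI) blast
    qed
    then show "(F \<longlongrightarrow> F s) (at s within {0..t})" by (rule LIM_zero_cancel)
  qed
  \<comment> \<open>an antiderivative of \<open>\<bar>y\<bar> powr p\<close> on the whole line\<close>
  define \<Psi> where "\<Psi> y = y * \<bar>y\<bar> powr p / (p + 1)" for y :: real
  have \<Psi>: "(\<Psi> has_real_derivative \<bar>y\<bar> powr p) (at y)" for y
    unfolding \<Psi>_def by (rule abs_powr_antiderivative[OF p])
  define \<kappa> where "\<kappa> b r = (\<Psi> (r - b) - \<Psi> r) / 2" for b r
  define c where "c n = (\<Sum>(a, u, v)\<leftarrow>S n. a * ((v powr p - u powr p) / 2))" for n
  define d where "d n b = (\<Sum>(a, u, v)\<leftarrow>S n. a * (\<kappa> b v - \<kappa> b u))" for n b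
  have Fn_int: "(Fn n has_integral (b * c n + d n b)) {0..b}" if b: "b \<in> {0..t}" for n b
  proof -
    have abs_int: "((\<lambda>s. \<bar>u - s\<bar> powr p) has_integral (\<Psi> u - \<Psi> (u - b))) {0..b}" for u
    proof -
      have "((\<lambda>s. - \<Psi> (u - s)) has_real_derivative \<bar>u - s\<bar> powr p) (at s within {0..b})" for s
      proof -
        have "((\<lambda>s. \<Psi> (u - s)) has_real_derivative \<bar>u - s\<bar> powr p * (- 1)) (at s)"
          by (rule DERIV_chain2[OF \<Psi>]) (auto intro!: derivative_eq_intros)
        from DERIV_minus[OF this] show ?thesis
          by (rule has_field_derivative_at_within[OF DERIV_cong]) simp
      qed
      then have "((\<lambda>s. \<bar>u - s\<bar> powr p) has_integral (- \<Psi> (u - b) - - \<Psi> (u - 0))) {0..b}"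
        using b by (intro fundamental_theorem_of_calculus)
          (auto simp flip: has_real_derivative_iff_has_vector_derivative)
      then show ?thesis by simp
    qed
    have list: "((\<lambda>s. \<Sum>(a, u, v)\<leftarrow>L. a * (((v powr p - u powr p) + (\<bar>u - s\<bar> powr p - \<bar>v - s\<bar> powr p)) / 2))
        has_integral (b * (\<Sum>(a, u, v)\<leftarrow>L. a * ((v powr p - u powr p) / 2)) +
          (\<Sum>(a, u, v)\<leftarrow>L. a * (\<kappa> b v - \<kappa> b u)))) {0..b}" for L :: "(real \<times> real \<times> real) list"
    proof (induction L)
      case (Cons x L)
      obtain a u v where x: "x = (a, u, v)" by (cases x)
      have "((\<lambda>s. (v powr p - u powr p) + (\<bar>u - s\<bar> powr p - \<bar>v - s\<bar> powr p)) has_integral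
          (b * (v powr p - u powr p) + ((\<Psi> u - \<Psi> (u - b)) - (\<Psi> v - \<Psi> (v - b))))) {0..b}"
        using has_integral_add[OF has_integral_const_real[of "v powr p - u powr p" 0 b]
            has_integral_diff[OF abs_int[of u] abs_int[of v]]] b by simp
      from has_integral_mult_right[OF this, of "a / 2"]
      have "((\<lambda>s. a * (((v powr p - u powr p) + (\<bar>u - s\<bar> powr p - \<bar>v - s\<bar> powr p)) / 2)) has_integral
          (b * (a * ((v powr p - u powr p) / 2)) + a * (\<kappa> b v - \<kappa> b u))) {0..b}"
        by (rule has_integral_eq_rhs[OF has_integral_eq[rotated]]) (simp_all add: \<kappa>_def field_simps)
      from has_integral_add[OF this Cons.IH] show ?case
        by (simp add: x algebra_simps)
    qed simp
    have "Fn n s = (\<Sum>(a, u, v)\<leftarrow>S n. a * (((v powr p - u powr p) + (\<bar>u - s\<bar> powr p - \<bar>v - s\<bar> powr p)) / 2))"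
      if s: "s \<in> {0..b}" for s
    proof -
      have s0: "0 \<le> s" using s by simp
      have "Fn n s = (\<Sum>(a, u, v)\<leftarrow>S n. a * ((\<integral>\<omega>. W v \<omega> * W s \<omega> \<partial>M) - (\<integral>\<omega>. W u \<omega> * W s \<omega> \<partial>M)))"
        unfolding Fn_def by (rule integral_step_integral_mult[OF S fbm_L2[OF s0]])
      also have "\<dots> = (\<Sum>(a, u, v)\<leftarrow>S n. a * (((v powr p - u powr p) + (\<bar>u - s\<bar> powr p - \<bar>v - s\<bar> powr p)) / 2))"
      proof (rule arg_cong[where f = sum_list], rule map_cong[OF refl], clarify)
        fix a u v assume "(a, u, v) \<in> set (S n)"
        then have "0 \<le> u" "0 \<le> v" using S[of n] by auto
        then show "a * ((\<integral>\<omega>. W v \<omega> * W s \<omega> \<partial>M) - (\<integral>\<omega>. W u \<omega> * W s \<omega> \<partial>M)) =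
            a * (((v powr p - u powr p) + (\<bar>u - s\<bar> powr p - \<bar>v - s\<bar> powr p)) / 2)"
          using s0 by (simp add: fbm_covariance p_def diff_divide_distrib add_divide_distrib)
      qed
      finally show ?thesis .
    qed
    then show ?thesis
      unfolding c_def d_def by (intro has_integral_eq[OF _ list]) simp
  qed
  have d: "(\<lambda>n. d n b) \<longlonglongrightarrow> 0" if b: "b \<in> {0..t}" for b
  proof -
    define k where "k r = (\<bar>r - b\<bar> powr p - \<bar>r\<bar> powr p) / 2" for r
    have der: "(\<kappa> b has_real_derivative k r) (at r)" for r
      unfolding \<kappa>_def[abs_def] k_def
    proof (intro DERIV_cdivide DERIV_diff \<Psi>)
      have "((\<lambda>r. \<Psi> (r - b)) has_real_derivative \<bar>r - b\<bar> powr p * 1) (at r)"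
        by (rule DERIV_chain2[OF \<Psi>]) (auto intro!: derivative_eq_intros)
      then show "((\<lambda>r. \<Psi> (r - b)) has_real_derivative \<bar>r - b\<bar> powr p) (at r)" by simp
    qed
    have kc: "continuous_on UNIV k"
      unfolding k_def[abs_def] using p by (intro continuous_intros continuous_on_powr') auto
    obtain B where "\<forall>r\<in>{0..t}. \<bar>k r\<bar> \<le> B"
    proof -
      have "compact (k ` {0..t})"
        by (rule compact_continuous_image) (use kc in \<open>auto intro: continuous_on_subset\<close>)
      then have "bounded (k ` {0..t})" by (rule compact_imp_bounded)
      then show ?thesis using that by (auto simp: bounded_iff)
    qed
    then have Lk: "L2 (lebesgue_on {0..t}) k"
      by (intro L2_lebesgue_on_bounded[of k t B] borel_imp_lebesgue_on borel_measurable_continuous_onI kc) blast+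
    have bound: "norm (d n b) \<le> L2_norm (lebesgue_on {0..t}) (step_fun (S n)) * L2_norm (lebesgue_on {0..t}) k" for n
      unfolding d_def integral_step_fun_mult[OF S der kc, symmetric] real_norm_def
      by (rule L2_Cauchy_Schwarz[OF step_fun_L2 Lk])
    show ?thesis
      by (rule Lim_null_comparison[OF always_eventually[OF allI[OF bound]] tendsto_mult_left_zero[OF null]])
  qed
  have lim: "(\<lambda>n. b * c n) \<longlonglongrightarrow> integral {0..b} F" if b: "b \<in> {0..t}" for b
  proof -
    have Fb: "(F has_integral integral {0..b} F) {0..b}"
      using cont b by (intro integrable_integral integrable_continuous_real)
        (auto intro: continuous_on_subset)
    have bound: "norm (b * c n + d n b - integral {0..b} F) \<le> \<epsilon> n * (t powr H * b)" for n
    proof -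
      have "norm (b * c n + d n b - integral {0..b} F) \<le> \<epsilon> n * t powr H * measure lborel {0..b}"
        using close b
        by (intro has_integral_bound_real[OF _ finite.emptyI has_integral_diff[OF Fn_int[OF b] Fb]])
          (auto simp: \<epsilon>_def L2_norm_nonneg)
      then show ?thesis using b by (simp add: mult.assoc)
    qed
    have "(\<lambda>n. b * c n + d n b - integral {0..b} F) \<longlonglongrightarrow> 0"
      by (rule Lim_null_comparison[OF always_eventually[OF allI[OF bound]] tendsto_mult_left_zero[OF \<epsilon>]])
    from tendsto_add[OF tendsto_diff[OF this d[OF b]] tendsto_const[of "integral {0..b} F"]]
    show ?thesis by simp
  qed
  define C where "C = integral {0..t} F / t"
  have "(\<lambda>n. t * c n / t) \<longlonglongrightarrow> integral {0..t} F / t"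
    using t by (intro tendsto_divide lim tendsto_const) auto
  then have c: "c \<longlonglongrightarrow> C" using t by (simp add: C_def)
  have int_F: "integral {0..b} F = b * C" if "b \<in> {0..t}" for b
    by (rule LIMSEQ_unique[OF lim[OF that] tendsto_mult_left[OF c]])
  have FC: "F s = C" if s: "s \<in> {0..t}" for s
  proof (rule vector_derivative_unique_within_closed_interval)
    show "0 < t" "s \<in> cbox 0 t" using t s by auto
    show "((\<lambda>b. integral {0..b} F) has_vector_derivative F s) (at s within cbox 0 t)"
      using integral_has_vector_derivative[OF cont s] by simp
    have "((\<lambda>b. b * C) has_vector_derivative C) (at s within {0..t})"
      by (auto intro!: derivative_eq_intros simp flip: has_real_derivative_iff_has_vector_derivative)
    then show "((\<lambda>b. integral {0..b} F) has_vector_derivative C) (at s within cbox 0 t)"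
      using int_F s by (auto intro: has_vector_derivative_transform[rotated 2])
  qed
  have "\<bar>F 0\<bar> \<le> L2_norm M (W 0) * L2_norm M Y"
    unfolding F_def by (intro L2_Cauchy_Schwarz fbm_L2 Y) simp
  then have "F 0 = 0" by (simp add: fbm_norm)
  then have F0: "F s = 0" if "s \<in> {0..t}" for s using FC[OF that] FC[of 0] t by simp
  \<comment> \<open>\<open>Y\<close> is now orthogonal to the integrals of the step functions, hence to itself, being their limit\<close>
  have orth: "(\<integral>\<omega>. step_integral W (S n) \<omega> * Y \<omega> \<partial>M) = 0" for n
  proof -
    have "(\<integral>\<omega>. step_integral W (S n) \<omega> * Y \<omega> \<partial>M) = (\<Sum>(a, u, v)\<leftarrow>S n. a * (F v - F u))"
      unfolding F_def by (rule integral_step_integral_mult[OF S Y])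
    also have "\<dots> = (\<Sum>x\<leftarrow>S n. 0)"
      using S[of n] by (intro arg_cong[where f = sum_list] map_cong refl) (force simp: F0)
    finally show ?thesis by simp
  qed
  have bound: "norm ((L2_norm M Y)\<^sup>2) \<le> \<epsilon> n * L2_norm M Y" for n
  proof -
    have "(L2_norm M Y)\<^sup>2 = (\<integral>\<omega>. Y \<omega> * Y \<omega> \<partial>M) - (\<integral>\<omega>. step_integral W (S n) \<omega> * Y \<omega> \<partial>M)"
      by (simp add: orth L2_norm_squared flip: power2_eq_square)
    also have "\<dots> = (\<integral>\<omega>. Y \<omega> * Y \<omega> - step_integral W (S n) \<omega> * Y \<omega> \<partial>M)"
      by (rule Bochner_Integration.integral_diff[symmetric]) (intro L2_mult_integrable LS Y)+
    also have "\<dots> = (\<integral>\<omega>. (Y \<omega> - step_integral W (S n) \<omega>) * Y \<omega> \<partial>M)"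
      by (simp add: algebra_simps)
    also have "norm \<dots> \<le> L2_norm M (\<lambda>\<omega>. Y \<omega> - step_integral W (S n) \<omega>) * L2_norm M Y"
      unfolding real_norm_def by (intro L2_Cauchy_Schwarz L2_diff LS Y)
    finally show ?thesis by (simp add: \<epsilon>_def L2_norm_minus_commute[of M Y])
  qed
  have "(\<lambda>n::nat. (L2_norm M Y)\<^sup>2) \<longlonglongrightarrow> 0"
    by (rule Lim_null_comparison[OF always_eventually[OF allI[OF bound]] tendsto_mult_left_zero[OF \<epsilon>]])
  then show ?thesis by (simp add: LIMSEQ_const_iff)
qed

text \<open>The difference of two approximating sequences tends to zero as a sequence of step functions,
  and its integrals tend to \<open>X - X'\<close>.\<close>

lemma wiener_integral_unique:
  assumes t: "0 < t" and X: "is_wiener_integral M W t \<phi> X" and X': "is_wiener_integral M W t \<phi> X'"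
  shows "L2_norm M (\<lambda>\<omega>. X \<omega> - X' \<omega>) = 0"
proof -
  obtain S where S: "\<And>n. \<forall>(a, u, v)\<in>set (S n). 0 \<le> u \<and> u \<le> v \<and> v \<le> t"
    "L2_converges (lebesgue_on {0..t}) (\<lambda>n. step_fun (S n)) \<phi>"
    "L2_converges M (\<lambda>n. step_integral W (S n)) X"
    using X unfolding is_wiener_integral_def by blast
  obtain S' where S': "\<And>n. \<forall>(a, u, v)\<in>set (S' n). 0 \<le> u \<and> u \<le> v \<and> v \<le> t"
    "L2_converges (lebesgue_on {0..t}) (\<lambda>n. step_fun (S' n)) \<phi>"
    "L2_converges M (\<lambda>n. step_integral W (S' n)) X'"
    using X' unfolding is_wiener_integral_def by blast
  show ?thesis
  proof (rule step_integral_closable[OF t])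
    show "\<forall>(a, u, v)\<in>set (step_diff (S n) (S' n)). 0 \<le> u \<and> u \<le> v \<and> v \<le> t" for n
      using S(1)[of n] S'(1)[of n] by (force simp: step_diff_def)
    show "(\<lambda>n. L2_norm (lebesgue_on {0..t}) (step_fun (step_diff (S n) (S' n)))) \<longlonglongrightarrow> 0"
      using L2_converges_diff[OF S(2) S'(2)] by (simp add: L2_converges_def step_fun_diff[abs_def])
    show "L2_converges M (\<lambda>n. step_integral W (step_diff (S n) (S' n))) (\<lambda>\<omega>. X \<omega> - X' \<omega>)"
      using L2_converges_diff[OF S(3) S'(3)] by (simp add: step_integral_diff[abs_def])
  qed
qed

end

section \<open>Wiener integrals of decreasing functions\<close>

text \<open>The step function on a uniform mesh of width \<open>t / N\<close> that takes the value \<open>c i\<close> where the reversed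
  time \<open>\<tau> = t - r\<close> lies in the \<open>i\<close>-th cell.\<close>

definition grid :: "real \<Rightarrow> nat \<Rightarrow> (nat \<Rightarrow> real) \<Rightarrow> (real \<times> real \<times> real) list" where
  "grid t N c = map (\<lambda>i. (c i, t - real (Suc i) * (t / N), t - real i * (t / N))) [0..<N]"

lemma grid_valid:
  assumes t: "0 < t" and N: "0 < N"
  shows "\<forall>(a, u, v)\<in>set (grid t N c). 0 \<le> u \<and> u \<le> v \<and> v \<le> t"
proof -
  have "real (Suc i) * (t / N) \<le> t" if "i < N" for i
  proof -
    have "real (Suc i) * (t / N) \<le> real N * (t / N)"
      using that t by (intro mult_right_mono) (auto simp del: of_nat_Suc)
    then show ?thesis using N by simp
  qed
  then show ?thesis using t by (auto simp: grid_def divide_right_mono)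
qed

lemma grid_step_integral:
  "step_integral W (grid t N c) \<omega> =
     (\<Sum>i<N. c i * (W (t - real i * (t / N)) \<omega> - W (t - real (Suc i) * (t / N)) \<omega>))"
  by (simp add: step_integral_def grid_def comp_def interv_sum_list_conv_sum_set_nat atLeast0LessThan
      del: of_nat_Suc)

lemma grid_step_fun:
  assumes t: "0 < t" and N: "0 < N" and r: "0 < r" "r \<le> t"
  shows "\<exists>i<N. real i * (t / N) \<le> t - r \<and> t - r < real (Suc i) * (t / N) \<and> (\<forall>c. step_fun (grid t N c) r = c i)"
proof -
  define h where "h = t / N"
  have h: "0 < h" "real N * h = t" using t N by (auto simp: h_def)
  define i where "i = nat \<lfloor>(t - r) / h\<rfloor>"
  have "0 \<le> (t - r) / h" using r h by simp
  then have "real i \<le> (t - r) / h" "(t - r) / h < real i + 1" unfolding i_def by linarith+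
  then have i: "real i * h \<le> t - r" "t - r < real (Suc i) * h"
    using h by (simp_all add: field_simps)
  have "real i * h < real N * h" using i(1) r h by linarith
  then have iN: "i < N" by (simp only: mult_less_cancel_right_pos[OF h(1)] of_nat_less_iff)
  have "step_fun (grid t N c) r = c i" for c
  proof -
    have "step_fun (grid t N c) r = (\<Sum>j<N. c j * indicator {t - real (Suc j) * h<..t - real j * h} r)"
      by (simp add: step_fun_def grid_def comp_def interv_sum_list_conv_sum_set_nat atLeast0LessThan h_def
        del: of_nat_Suc)
    also have "\<dots> = (\<Sum>j<N. if j = i then c j else 0)"
    proof (rule sum.cong[OF refl])
      fix j
      have only: "j = i" if "r \<in> {t - real (Suc j) * h<..t - real j * h}"
      proof -
        have "real j * h < real (Suc i) * h" "real i * h < real (Suc j) * h"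
          using that i by auto
        then have "j < Suc i" "i < Suc j" by (simp_all only: mult_less_cancel_right_pos[OF h(1)] of_nat_less_iff)
        then show ?thesis by simp
      qed
      have mem: "r \<in> {t - real (Suc i) * h<..t - real i * h}" using i by auto
      show "c j * indicator {t - real (Suc j) * h<..t - real j * h} r = (if j = i then c j else 0)"
      proof (cases "j = i")
        case True
        then show ?thesis using mem by (simp only: indicator_simps simp_thms if_True mult_1_right)
      next
        case False
        then have "r \<notin> {t - real (Suc j) * h<..t - real j * h}" using only by blast
        then show ?thesis using False by (simp only: indicator_simps simp_thms if_False mult_zero_right)
      qed
    qed
    finally show ?thesis using iN by simp
  qed
  then show ?thesis using i iN unfolding h_def by blast
qed

lemma integral_grid:
  assumes t: "0 < t" and N: "0 < N"
  shows "(\<integral>r. step_fun (grid t N c) r \<partial>lebesgue_on {0..t}) = (\<Sum>i<N. c i) * (t / N)"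
proof -
  have "(\<integral>r. step_fun (grid t N c) r * 1 \<partial>lebesgue_on {0..t}) = (\<Sum>(a, u, v)\<leftarrow>grid t N c. a * (v - u))"
    by (rule integral_step_fun_mult[OF grid_valid[OF t N]]) auto
  also have "\<dots> = (\<Sum>i<N. c i * (t / N))"
    by (simp add: grid_def comp_def interv_sum_list_conv_sum_set_nat atLeast0LessThan left_diff_distrib[symmetric]
      del: of_nat_Suc) (simp add: algebra_simps add_divide_distrib)
  finally show ?thesis by (simp only: mult_1_right sum_distrib_right)
qed

lemma abel_summation:
  fixes b c :: "nat \<Rightarrow> real"
  assumes "b 0 = 0"
  shows "(\<Sum>i<N. c i * (b (Suc i) - b i)) = c N * b N + (\<Sum>i<N. (c i - c (Suc i)) * b (Suc i))"
  by (induction N) (auto simp: assms algebra_simps)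

text \<open>The discrete form of \<open>\<integral> x powr (- \<beta>) d(x\<^sup>H) = H / (H - \<beta>) \<integral> d(x powr (H - \<beta>))\<close> over \<open>[a, b]\<close>, where
  the factor \<open>x powr (- \<beta>)\<close> is replaced by its smallest value. The difference of the two sides,
  as a function of \<open>a\<close>, is monotone and vanishes at \<open>b\<close>.\<close>

lemma powr_increment_le:
  fixes a b H \<beta> :: real
  assumes \<beta>: "0 \<le> \<beta>" "\<beta> < H" and a: "0 \<le> a" "a \<le> b" and b: "0 < b"
  shows "b powr (- \<beta>) * (b powr H - a powr H) \<le> H / (H - \<beta>) * (b powr (H - \<beta>) - a powr (H - \<beta>))"
proof -
  define F where "F x = H / (H - \<beta>) * x powr (H - \<beta>) - b powr (- \<beta>) * x powr H" for x
  have "F a \<le> F b"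
  proof (rule DERIV_nonneg_imp_increasing_open[OF a(2)])
    fix x assume x: "a < x" "x < b"
    then have x0: "0 < x" using a by simp
    have "(F has_real_derivative (H / (H - \<beta>) * ((H - \<beta>) * x powr (H - \<beta> - 1)) - b powr (- \<beta>) * (H * x powr (H - 1)))) (at x)"
      unfolding F_def[abs_def] using x0 by (intro DERIV_diff DERIV_cmult has_real_derivative_powr)
    moreover have "0 \<le> H / (H - \<beta>) * ((H - \<beta>) * x powr (H - \<beta> - 1)) - b powr (- \<beta>) * (H * x powr (H - 1))"
    proof -
      have "x powr (H - \<beta> - 1) = x powr (- \<beta>) * x powr (H - 1)" by (simp add: algebra_simps flip: powr_add)
      moreover have "b powr (- \<beta>) \<le> x powr (- \<beta>)" using x x0 \<beta> by (intro powr_mono2') auto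
      then have "b powr (- \<beta>) * (H * x powr (H - 1)) \<le> x powr (- \<beta>) * (H * x powr (H - 1))"
        using \<beta> by (intro mult_right_mono) auto
      ultimately show ?thesis using \<beta> by simp
    qed
    ultimately show "\<exists>y. (F has_real_derivative y) (at x) \<and> 0 \<le> y" by blast
  next
    show "continuous_on {a..b} F"
      unfolding F_def[abs_def] using a \<beta> by (intro continuous_intros continuous_on_powr') auto
  qed
  moreover have "b powr (- \<beta>) * b powr H = b powr (H - \<beta>)" by (simp flip: powr_add)
  ultimately have "b powr (- \<beta>) * (b powr H - a powr H) \<le> H / (H - \<beta>) * b powr (H - \<beta>) - H / (H - \<beta>) * a powr (H - \<beta>)"
    unfolding F_def right_diff_distrib by linarith
  then show ?thesis by (simp only: right_diff_distrib)
qed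

context
  fixes t :: real and e :: "real \<Rightarrow> real"
  assumes t: "0 < t" and e_nonneg: "\<And>\<tau>. 0 \<le> \<tau> \<Longrightarrow> 0 \<le> e \<tau>"
    and e_anti: "\<And>\<tau> \<tau>'. 0 \<le> \<tau> \<Longrightarrow> \<tau> \<le> \<tau>' \<Longrightarrow> e \<tau>' \<le> e \<tau>"
begin

text \<open>Each cell carries the value of \<open>e\<close> at its far end in reversed time. The steps then lie below
  \<open>e\<close>, and any upper bound for \<open>e\<close> that is singular at \<open>0\<close> is only evaluated at positive times.\<close>

abbreviation (input) mesh_steps :: "nat \<Rightarrow> (real \<times> real \<times> real) list" where
  "mesh_steps N \<equiv> grid t N (\<lambda>i. e (real (Suc i) * (t / N)))"

lemma reversed_antimono_L2: "L2 (lebesgue_on {0..t}) (\<lambda>r. e (t - r))"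
proof (rule L2_lebesgue_on_bounded)
  have "mono (\<lambda>r. e (max 0 (t - r)))"
    by (intro monoI e_anti) auto
  then have "(\<lambda>r. e (max 0 (t - r))) \<in> borel_measurable (lebesgue_on {0..t})"
    by (intro borel_imp_lebesgue_on borel_measurable_mono)
  then show "(\<lambda>r. e (t - r)) \<in> borel_measurable (lebesgue_on {0..t})"
    by (rule measurable_cong[THEN iffD1, rotated]) (auto simp: max_def)
  show "\<bar>e (t - r)\<bar> \<le> e 0" if "r \<in> {0..t}" for r
    using e_nonneg[of "t - r"] e_anti[of 0 "t - r"] that by simp
qed

lemma mesh_telescope: "(\<Sum>i<N. e (real i * h) - e (real (Suc i) * h)) = e 0 - e (real N * h)"
  by (induction N) auto

text \<open>On each cell the error is at most the drop of \<open>e\<close> across the cell, and these drops add up to at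
  most \<open>e 0\<close>. So the \<open>L\<^sup>1\<close> error is at most \<open>e 0\<close> times the mesh width, and the pointwise error at most
  \<open>e 0\<close>.\<close>

lemma mesh_steps_L2_converges:
  assumes N: "0 < N"
  shows "(L2_norm (lebesgue_on {0..t}) (\<lambda>r. step_fun (mesh_steps N) r - e (t - r)))\<^sup>2 \<le> (e 0)\<^sup>2 * t / N"
proof -
  let ?M = "lebesgue_on {0..t}" and ?h = "t / N"
  define c where "c i = e (real i * ?h) - e (real (Suc i) * ?h)" for i
  have h: "0 < ?h" using t N by simp
  have AE: "AE r in ?M. (norm (step_fun (mesh_steps N) r - e (t - r)))\<^sup>2 \<le> e 0 * step_fun (grid t N c) r"
  proof -
    \<comment> \<open>the cells are open at their left ends, so they miss the point \<open>0\<close>\<close>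
    have "AE r in lebesgue. r \<noteq> (0::real)" by (rule AE_completion[OF AE_lborel_singleton])
    then have "AE r in ?M. r \<noteq> 0"
      by (subst AE_restrict_space_iff) (simp, erule eventually_mono, simp)
    moreover have "AE r in ?M. r \<in> {0..t}" by (rule AE_I2) simp
    ultimately show ?thesis
    proof eventually_elim
      case (elim r)
      obtain i where i: "i < N" "real i * ?h \<le> t - r" "t - r < real (Suc i) * ?h"
        "\<And>c. step_fun (grid t N c) r = c i"
        using grid_step_fun[OF t N, of r] elim by auto
      have i0: "0 \<le> real i * ?h" "0 \<le> t - r" using h elim by auto
      have le: "0 \<le> e (t - r) - e (real (Suc i) * ?h)" "e (t - r) - e (real (Suc i) * ?h) \<le> c i"
          "e (t - r) - e (real (Suc i) * ?h) \<le> e 0"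
        using e_anti[OF i0(1) i(2)] e_anti[OF i0(2), of "real (Suc i) * ?h"] e_anti[OF order_refl i0(2)] i(3)
          e_nonneg[of "real (Suc i) * ?h"] i0 unfolding c_def by linarith+
      have "(norm (step_fun (mesh_steps N) r - e (t - r)))\<^sup>2 =
          (e (t - r) - e (real (Suc i) * ?h)) * (e (t - r) - e (real (Suc i) * ?h))"
        unfolding i(4) by (simp add: power2_eq_square algebra_simps)
      also have "\<dots> \<le> e 0 * c i" using le by (intro mult_mono) auto
      finally show ?case unfolding i(4) .
    qed
  qed
  have int: "integrable ?M (\<lambda>r. e 0 * step_fun (grid t N c) r)"
  proof -
    have "L2 ?M (\<lambda>r. 1::real)" by (rule L2_lebesgue_on_bounded[where B = 1]) auto
    from L2_mult_integrable[OF step_fun_L2 this, of "grid t N c"] show ?thesis by simp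
  qed
  have "(L2_norm ?M (\<lambda>r. step_fun (mesh_steps N) r - e (t - r)))\<^sup>2 \<le> (\<integral>r. e 0 * step_fun (grid t N c) r \<partial>?M)"
    unfolding L2_norm_squared
  proof (rule integral_mono_AE'[OF int AE])
    show "AE r in ?M. 0 \<le> e 0 * step_fun (grid t N c) r"
      using AE by eventually_elim (meson order_trans zero_le_power2)
  qed
  also have "\<dots> = e 0 * ((\<Sum>i<N. c i) * ?h)" by (simp add: integral_grid[OF t N])
  also have "(\<Sum>i<N. c i) = e 0 - e t" unfolding c_def mesh_telescope using N by simp
  also have "e 0 * ((e 0 - e t) * ?h) \<le> e 0 * (e 0 * ?h)"
    using e_nonneg[of 0] e_nonneg[of t] t h by (intro mult_left_mono mult_right_mono) auto
  finally show ?thesis by (simp add: power2_eq_square)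
qed

context
  fixes M :: "'w measure" and W :: "real \<Rightarrow> 'w \<Rightarrow> real" and H :: real
  assumes M: "prob_space M" and fbm: "fractional_brownian_motion M H W" and H: "0 < H"
begin

text \<open>Abel summation is applied twice: in the first direction to write the integral with the
  nonnegative weights \<open>c\<^sub>i - c\<^sub>i\<^sub>+\<^sub>1\<close> in front of the increments \<open>b\<^sub>i\<close>, whose norms are \<open>\<tau>\<^sub>i\<^sup>H\<close>, and after the
  triangle inequality backwards. This gives a Riemann-Stieltjes sum of \<open>e\<close> with respect to \<open>\<tau>\<^sup>H\<close>.\<close>

lemma mesh_integral_bound:
  assumes N: "0 < N" and \<beta>: "0 \<le> \<beta>" "\<beta> < H" and G: "0 \<le> G"
    and decay: "\<And>\<tau>. 0 < \<tau> \<Longrightarrow> e \<tau> \<le> G * \<tau> powr (- \<beta>)"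
  shows "L2_norm M (step_integral W (mesh_steps N)) \<le> G * (H / (H - \<beta>)) * t powr (H - \<beta>)"
proof -
  define h where "h = t / N"
  have h: "0 < h" "real N * h = t" using t N by (auto simp: h_def)
  define c where "c i = e (real (Suc i) * h)" for i
  define b where "b i \<omega> = W t \<omega> - W (t - real i * h) \<omega>" for i \<omega>
  have ih: "0 \<le> real i * h" "0 \<le> t - real i * h" if "i \<le> N" for i
  proof -
    have "real i * h \<le> real N * h" using that h by (intro mult_right_mono) auto
    then show "0 \<le> real i * h" "0 \<le> t - real i * h" using h by auto
  qed
  have c_nonneg: "0 \<le> c i" for i using h by (auto simp: c_def intro!: e_nonneg)
  have c_anti: "c (Suc i) \<le> c i" for i
    unfolding c_def using h by (intro e_anti) (auto intro!: mult_right_mono)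
  have Lb: "L2 M (b i)" if "i \<le> N" for i
    unfolding b_def using ih[OF that] t by (intro L2_diff fbm_L2[OF M fbm H]) auto
  have nb: "L2_norm M (b i) = (real i * h) powr H" if "i \<le> N" for i
    unfolding b_def using fbm_increment[OF M fbm H, of "t - real i * h" t] ih[OF that] t by simp
  have "step_integral W (mesh_steps N) \<omega> = (\<Sum>i<N. c i * (b (Suc i) \<omega> - b i \<omega>))" for \<omega>
    unfolding grid_step_integral c_def b_def h_def by (simp add: algebra_simps)
  also have "(\<Sum>i<N. c i * (b (Suc i) \<omega> - b i \<omega>)) = c N * b N \<omega> + (\<Sum>i<N. (c i - c (Suc i)) * b (Suc i) \<omega>)" for \<omega>
    by (rule abel_summation) (simp add: b_def)
  finally have "L2_norm M (step_integral W (mesh_steps N)) =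
      L2_norm M (\<lambda>\<omega>. c N * b N \<omega> + (\<Sum>i<N. (c i - c (Suc i)) * b (Suc i) \<omega>))"
    by presburger
  also have "\<dots> \<le> L2_norm M (\<lambda>\<omega>. c N * b N \<omega>) + L2_norm M (\<lambda>\<omega>. \<Sum>i<N. (c i - c (Suc i)) * b (Suc i) \<omega>)"
    by (intro L2_norm_triangle L2_sum L2_cmult Lb) auto
  also have "\<dots> \<le> L2_norm M (\<lambda>\<omega>. c N * b N \<omega>) + (\<Sum>i<N. L2_norm M (\<lambda>\<omega>. (c i - c (Suc i)) * b (Suc i) \<omega>))"
    by (intro add_left_mono L2_norm_sum_le L2_cmult Lb) auto
  also have "\<dots> = c N * (real N * h) powr H + (\<Sum>i<N. (c i - c (Suc i)) * (real (Suc i) * h) powr H)"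
    using c_nonneg[of N] c_anti by (simp add: L2_norm_cmult nb del: of_nat_Suc)
  also have "\<dots> = (\<Sum>i<N. c i * ((real (Suc i) * h) powr H - (real i * h) powr H))"
    by (rule abel_summation[symmetric]) simp
  also have "\<dots> \<le> (\<Sum>i<N. G * (H / (H - \<beta>)) * ((real (Suc i) * h) powr (H - \<beta>) - (real i * h) powr (H - \<beta>)))"
  proof (rule sum_mono)
    fix i
    have pos: "0 < real (Suc i) * h" using h(1) by (intro mult_pos_pos) auto
    have le: "0 \<le> real i * h" "real i * h \<le> real (Suc i) * h"
      using h(1) by (auto intro!: mult_right_mono)
    have "c i * ((real (Suc i) * h) powr H - (real i * h) powr H) \<le>
        G * (real (Suc i) * h) powr (- \<beta>) * ((real (Suc i) * h) powr H - (real i * h) powr H)"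
      using decay[OF pos] le H unfolding c_def by (intro mult_right_mono) (auto intro!: powr_mono2)
    also have "\<dots> \<le> G * (H / (H - \<beta>) * ((real (Suc i) * h) powr (H - \<beta>) - (real i * h) powr (H - \<beta>)))"
      unfolding mult.assoc by (intro mult_left_mono powr_increment_le \<beta> le pos G)
    finally show "c i * ((real (Suc i) * h) powr H - (real i * h) powr H) \<le>
       G * (H / (H - \<beta>)) * ((real (Suc i) * h) powr (H - \<beta>) - (real i * h) powr (H - \<beta>))"
      by (simp only: mult.assoc)
  qed
  also have "\<dots> = G * (H / (H - \<beta>)) * ((real N * h) powr (H - \<beta>) - (real 0 * h) powr (H - \<beta>))"
    unfolding sum_distrib_left[symmetric]
    using sum_lessThan_telescope[of "\<lambda>i. (real i * h) powr (H - \<beta>)" N] by (simp only:)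
  finally show ?thesis by (simp add: h)
qed

text \<open>Halving the mesh changes the step function only on every second cell, and there by the drop of
  \<open>e\<close>. The norms of the corresponding increments of \<open>W\<close> are all equal to a power of the new mesh
  width, and the drops add up to at most \<open>e 0\<close>.\<close>

lemma mesh_refinement_bound:
  assumes N: "0 < N"
  shows "L2_norm M (\<lambda>\<omega>. step_integral W (mesh_steps (2 * N)) \<omega> - step_integral W (mesh_steps N) \<omega>)
      \<le> e 0 * (t / real (2 * N)) powr H"
proof -
  define h where "h = t / real (2 * N)"
  have h: "0 < h" "t / real N = 2 * h" "t / real (2 * N) = h" using t N by (auto simp: h_def)
  define D where "D i \<omega> = W (t - real (2 * i) * h) \<omega> - W (t - real (Suc (2 * i)) * h) \<omega>" for i \<omega>
  define c where "c i = e (real (Suc (2 * i)) * h) - e (real (Suc (Suc (2 * i))) * h)" for i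
  have split: "(\<Sum>j<2 * N. g j) = (\<Sum>i<N. g (2 * i) + g (Suc (2 * i)))" for g :: "nat \<Rightarrow> real"
    by (induction N) (auto simp: add.assoc)
  have two: "real i * (2 * h) = real (2 * i) * h" for i by simp
  have eq: "step_integral W (mesh_steps (2 * N)) \<omega> - step_integral W (mesh_steps N) \<omega> = (\<Sum>i<N. c i * D i \<omega>)" for \<omega>
    unfolding grid_step_integral h split sum_subtractf[symmetric] two
    by (intro sum.cong refl) (simp add: c_def D_def mult_2_right algebra_simps del: of_nat_Suc of_nat_mult of_nat_add)
  have ih: "0 \<le> t - real j * h" if "j \<le> 2 * N" for j
  proof -
    have "real j * h \<le> real (2 * N) * h" using that h by (intro mult_right_mono) auto
    then show ?thesis using N by (simp add: h_def)
  qed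
  have LD: "L2 M (D i)" if "i < N" for i
    unfolding D_def using that by (intro L2_diff fbm_L2[OF M fbm H] ih) auto
  have nD: "L2_norm M (D i) = h powr H" if "i < N" for i
  proof -
    have "L2_norm M (D i) = \<bar>(t - real (2 * i) * h) - (t - real (Suc (2 * i)) * h)\<bar> powr H"
      unfolding D_def using that by (intro fbm_increment[OF M fbm H] ih) auto
    also have "(t - real (2 * i) * h) - (t - real (Suc (2 * i)) * h) = h" by (simp add: algebra_simps)
    finally show ?thesis using h by simp
  qed
  have anti: "e (real (Suc j) * h) \<le> e (real j * h)" for j
    using h by (intro e_anti) (auto intro!: mult_right_mono)
  have "L2_norm M (\<lambda>\<omega>. \<Sum>i<N. c i * D i \<omega>) \<le> (\<Sum>i<N. L2_norm M (\<lambda>\<omega>. c i * D i \<omega>))"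
    by (intro L2_norm_sum_le L2_cmult LD) auto
  also have "\<dots> = (\<Sum>i<N. c i) * h powr H"
    using anti by (simp add: L2_norm_cmult nD c_def sum_distrib_right del: of_nat_Suc)
  also have "\<dots> \<le> e 0 * h powr H"
  proof (rule mult_right_mono)
    have "(\<Sum>i<N. c i) \<le> (\<Sum>i<N. (e (real (2 * i) * h) - e (real (Suc (2 * i)) * h)) + c i)"
      using anti by (intro sum_mono) (simp del: of_nat_Suc of_nat_mult)
    also have "\<dots> = (\<Sum>j<2 * N. e (real j * h) - e (real (Suc j) * h))"
      unfolding split c_def by (rule refl)
    also have "\<dots> \<le> e 0"
      unfolding mesh_telescope using h by (simp add: e_nonneg)
    finally show "(\<Sum>i<N. c i) \<le> e 0" .
  qed simp
  finally show ?thesis unfolding eq unfolding h(3) .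
qed

text \<open>The integrals over the meshes with \<open>2\<^sup>n\<close> cells converge geometrically in \<open>L\<^sup>2\<close>, so a Wiener integral
  exists and inherits their norm bound. By uniqueness the bound carries over to the one that
  the choice operator in the definition of \<open>wiener_integral\<close> selects.\<close>

lemma wiener_integral_antimono:
  assumes \<beta>: "0 \<le> \<beta>" "\<beta> < H" and G: "0 \<le> G"
    and decay: "\<And>\<tau>. 0 < \<tau> \<Longrightarrow> e \<tau> \<le> G * \<tau> powr (- \<beta>)"
  shows "L2 M (wiener_integral M W t (\<lambda>r. e (t - r)))"
    and "L2_norm M (wiener_integral M W t (\<lambda>r. e (t - r))) \<le> G * (H / (H - \<beta>)) * t powr (H - \<beta>)"
proof -
  define S where "S n = mesh_steps (2 ^ n)" for n :: nat
  have S: "\<forall>(a, u, v)\<in>set (S n). 0 \<le> u \<and> u \<le> v \<and> v \<le> t" for n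
    unfolding S_def by (rule grid_valid[OF t]) simp
  have LS: "L2 M (step_integral W (S n))" for n by (rule step_integral_L2[OF M fbm H S])
  have "\<exists>X. L2_converges M (\<lambda>n. step_integral W (S n)) X"
  proof (rule L2_complete_geometric[OF M LS, of "2 powr (- H)" "e 0 * t powr H"])
    show "L2_norm M (\<lambda>\<omega>. step_integral W (S (Suc n)) \<omega> - step_integral W (S n) \<omega>)
        \<le> e 0 * t powr H * (2 powr (- H)) ^ n" for n
    proof -
      have "(t / real (2 * 2 ^ n)) powr H \<le> (t / 2 ^ n) powr H"
        using t H by (intro powr_mono2) (auto simp: field_simps)
      also have "\<dots> = t powr H * (2 powr (- H)) ^ n"
      proof -
        have "(2 ^ n) powr H = (2 powr H) ^ n"
          by (simp add: powr_powr mult.commute flip: powr_realpow)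
        then show ?thesis unfolding powr_divide powr_minus
          by (simp add: power_inverse divide_inverse)
      qed
      finally have "e 0 * (t / real (2 * 2 ^ n)) powr H \<le> e 0 * (t powr H * (2 powr (- H)) ^ n)"
        using e_nonneg[of 0] by (intro mult_left_mono) auto
      then show ?thesis
        using mesh_refinement_bound[of "2 ^ n"] unfolding S_def power_Suc by (simp add: mult.assoc)
    qed
    show "2 powr (- H) < 1" using H by (simp add: powr_less_one)
  qed (use e_nonneg[of 0] in auto)
  then obtain X where X: "L2_converges M (\<lambda>n. step_integral W (S n)) X" by blast
  have LX: "L2 M X" using X by (simp add: L2_converges_def)
  have "is_wiener_integral M W t (\<lambda>r. e (t - r)) X"
    unfolding is_wiener_integral_def
  proof (intro exI[of _ S] conjI allI X)
    show "\<forall>(a, u, v)\<in>set (S n). 0 \<le> u \<and> u \<le> v \<and> v \<le> t" for n by (rule S)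
    have bound: "norm (L2_norm (lebesgue_on {0..t}) (\<lambda>r. step_fun (S n) r - e (t - r))) \<le> e 0 * sqrt t * sqrt ((1 / 2) ^ n)" for n
    proof -
      have "L2_norm (lebesgue_on {0..t}) (\<lambda>r. step_fun (S n) r - e (t - r)) \<le> sqrt ((e 0)\<^sup>2 * t / real (2 ^ n))"
        unfolding S_def by (rule real_le_rsqrt[OF mesh_steps_L2_converges]) simp
      also have "\<dots> = e 0 * sqrt t * sqrt ((1 / 2) ^ n)"
      proof -
        have "(e 0)\<^sup>2 * t / real (2 ^ n) = (e 0)\<^sup>2 * t * (1 / 2) ^ n" by (simp add: power_one_over)
        then show ?thesis
          by (simp only: real_sqrt_mult real_sqrt_abs abs_of_nonneg[OF e_nonneg[OF order_refl]])
      qed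
      finally show ?thesis by (simp add: L2_norm_nonneg)
    qed
    have "(\<lambda>n. e 0 * sqrt t * sqrt ((1 / 2) ^ n)) \<longlonglongrightarrow> e 0 * sqrt t * sqrt 0"
      by (intro tendsto_intros LIMSEQ_power_zero) simp
    then have "(\<lambda>n. e 0 * sqrt t * sqrt ((1 / 2) ^ n)) \<longlonglongrightarrow> 0" by simp
    from Lim_null_comparison[OF always_eventually[OF allI[OF bound]] this]
    show "L2_converges (lebesgue_on {0..t}) (\<lambda>n. step_fun (S n)) (\<lambda>r. e (t - r))"
      by (simp add: L2_converges_def step_fun_L2 reversed_antimono_L2)
  qed
  moreover from this have wiener: "is_wiener_integral M W t (\<lambda>r. e (t - r)) (wiener_integral M W t (\<lambda>r. e (t - r)))"
    unfolding wiener_integral_def by (rule someI[of "is_wiener_integral M W t (\<lambda>r. e (t - r))"])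
  ultimately have dist: "L2_norm M (\<lambda>\<omega>. wiener_integral M W t (\<lambda>r. e (t - r)) \<omega> - X \<omega>) = 0"
    by (intro wiener_integral_unique[OF M fbm H t])
  show L: "L2 M (wiener_integral M W t (\<lambda>r. e (t - r)))"
    using wiener unfolding is_wiener_integral_def L2_converges_def by blast
  have "L2_norm M X \<le> G * (H / (H - \<beta>)) * t powr (H - \<beta>)"
  proof (rule LIMSEQ_le_const2[OF L2_norm_tendsto[OF X]])
    show "\<exists>N. \<forall>n\<ge>N. L2_norm M (step_integral W (S n)) \<le> G * (H / (H - \<beta>)) * t powr (H - \<beta>)"
      unfolding S_def by (intro exI[of _ 0] allI impI) (rule mesh_integral_bound[OF _ \<beta> G decay], simp_all)
  qed
  then show "L2_norm M (wiener_integral M W t (\<lambda>r. e (t - r))) \<le> G * (H / (H - \<beta>)) * t powr (H - \<beta>)"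
    using L2_norm_triangle[OF L2_diff[OF L LX] LX] dist by simp
qed

end
end

section \<open>Positivity of the Dirichlet eigenvalues\<close>

lemma L2_inner_integrable:
  fixes F G :: "'b \<Rightarrow> 'c::euclidean_space"
  assumes F: "L2 M F" and G: "L2 M G"
  shows "integrable M (\<lambda>x. F x \<bullet> G x)"
proof (rule Bochner_Integration.integrable_bound)
  show "integrable M (\<lambda>x. norm (F x) * norm (G x))"
    using F G by (intro L2_mult_integrable L2_norm_fun)
  show "(\<lambda>x. F x \<bullet> G x) \<in> borel_measurable M"
    using F G by (auto simp: L2_def)
  show "AE x in M. norm (F x \<bullet> G x) \<le> norm (norm (F x) * norm (G x))"
    by (rule AE_I2) (simp add: Cauchy_Schwarz_ineq2)
qed

lemma L2_inner_bound:
  fixes F G :: "'b \<Rightarrow> 'c::euclidean_space"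
  assumes F: "L2 M F" and G: "L2 M G"
  shows "\<bar>\<integral>x. F x \<bullet> G x \<partial>M\<bar> \<le> L2_norm M F * L2_norm M G"
proof -
  have "\<bar>\<integral>x. F x \<bullet> G x \<partial>M\<bar> \<le> (\<integral>x. \<bar>F x \<bullet> G x\<bar> \<partial>M)" by (rule integral_abs_bound)
  also have "\<dots> \<le> (\<integral>x. norm (F x) * norm (G x) \<partial>M)"
    using F G by (intro integral_mono' L2_mult_integrable L2_norm_fun Cauchy_Schwarz_ineq2) auto
  also have "\<dots> \<le> L2_norm M (\<lambda>x. norm (F x)) * L2_norm M (\<lambda>x. norm (G x))"
    using L2_Cauchy_Schwarz[OF L2_norm_fun[OF F] L2_norm_fun[OF G]] by linarith
  finally show ?thesis by (simp add: L2_norm_def)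
qed

lemma L2_inner_tendsto:
  fixes F :: "nat \<Rightarrow> 'b \<Rightarrow> 'c::euclidean_space"
  assumes F: "L2_converges M F f" and G: "L2 M G"
  shows "(\<lambda>n. \<integral>x. G x \<bullet> F n x \<partial>M) \<longlonglongrightarrow> (\<integral>x. G x \<bullet> f x \<partial>M)"
proof -
  have L: "L2 M (F n)" "L2 M f" for n using F by (auto simp: L2_converges_def)
  have bound: "norm ((\<integral>x. G x \<bullet> F n x \<partial>M) - (\<integral>x. G x \<bullet> f x \<partial>M)) \<le> L2_norm M G * L2_norm M (\<lambda>x. F n x - f x)" for n
  proof -
    have "(\<integral>x. G x \<bullet> F n x \<partial>M) - (\<integral>x. G x \<bullet> f x \<partial>M) = (\<integral>x. G x \<bullet> F n x - G x \<bullet> f x \<partial>M)"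
      by (rule Bochner_Integration.integral_diff[symmetric]) (intro L2_inner_integrable G L)+
    also have "\<dots> = (\<integral>x. G x \<bullet> (F n x - f x) \<partial>M)" by (simp add: inner_diff_right)
    finally show ?thesis
      unfolding real_norm_def by (simp only:) (intro L2_inner_bound L2_diff G L)
  qed
  have "(\<lambda>n. L2_norm M (\<lambda>x. F n x - f x)) \<longlonglongrightarrow> 0" using F by (simp add: L2_converges_def)
  from Lim_null_comparison[OF always_eventually[OF allI[OF bound]] tendsto_mult_right_zero[OF this]]
  show ?thesis by (rule LIM_zero_cancel)
qed

lemma integrable_lborel_compact_support:
  fixes f :: "'a::euclidean_space \<Rightarrow> real"
  assumes "continuous_on UNIV f" and "\<And>x. R < norm x \<Longrightarrow> f x = 0"
  shows "integrable lborel f"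
proof -
  have "integrable lborel (\<lambda>x. indicator (cball 0 R) x *\<^sub>R f x)"
    by (rule borel_integrable_compact) (use assms(1) in \<open>auto intro: continuous_on_subset\<close>)
  also have "(\<lambda>x. indicator (cball 0 R) x *\<^sub>R f x) = f"
    using assms(2) by (auto simp: fun_eq_iff indicator_def)
  finally show ?thesis .
qed

lemma integral_lborel_translation:
  fixes f :: "'a::euclidean_space \<Rightarrow> real"
  assumes "f \<in> borel_measurable borel"
  shows "(\<integral>x. f (x + c) \<partial>lborel) = (\<integral>x. f x \<partial>lborel)"
proof -
  have "(\<integral>x. f x \<partial>distr lborel borel ((+) c)) = (\<integral>x. f (c + x) \<partial>lborel)"
    using assms by (intro integral_distr) auto
  then show ?thesis by (simp add: lborel_distr_plus add.commute)
qed

text \<open>By translation invariance of Lebesgue measure the difference quotients have integral zero;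
  they converge boundedly with supports in a fixed ball.\<close>

lemma integral_directional_derivative_eq_0:
  fixes f f' :: "'a::euclidean_space \<Rightarrow> real"
  assumes der: "\<And>x s. ((\<lambda>s. f (x + s *\<^sub>R b)) has_real_derivative f' (x + s *\<^sub>R b)) (at s)"
    and cont: "continuous_on UNIV f" and cont': "continuous_on UNIV f'"
    and supp: "\<And>x. R < norm x \<Longrightarrow> f x = 0"
  shows "(\<integral>x. f' x \<partial>lborel) = 0"
proof -
  have [measurable]: "f \<in> borel_measurable borel" "f' \<in> borel_measurable borel"
    using cont cont' by (auto intro: borel_measurable_continuous_onI)
  define \<delta> where "\<delta> n = inverse (real (Suc n))" for n
  have \<delta>: "0 < \<delta> n" "\<delta> n \<le> 1" for n by (auto simp: \<delta>_def inverse_le_1_iff)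
  define q where "q n x = (f (x + \<delta> n *\<^sub>R b) - f x) / \<delta> n" for n x
  have [measurable]: "q n \<in> borel_measurable borel" for n unfolding q_def by measurable
  \<comment> \<open>The difference quotient at \<open>x\<close> vanishes unless \<open>norm x \<le> R + norm b\<close>, and the mean value theorem
    evaluates \<open>f'\<close> within distance \<open>norm b\<close> of \<open>x\<close>.\<close>
  obtain B where B: "\<And>x. norm x \<le> R + 2 * norm b \<Longrightarrow> \<bar>f' x\<bar> \<le> B"
  proof -
    have "compact (f' ` cball 0 (R + 2 * norm b))"
      by (rule compact_continuous_image) (use cont' in \<open>auto intro: continuous_on_subset\<close>)
    then have "bounded (f' ` cball 0 (R + 2 * norm b))" by (rule compact_imp_bounded)
    then obtain B where "\<forall>x\<in>cball 0 (R + 2 * norm b). \<bar>f' x\<bar> \<le> B" by (auto simp: bounded_iff)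
    then show ?thesis by (intro that[of B]) simp
  qed
  have intf: "integrable lborel f" by (rule integrable_lborel_compact_support[OF cont supp])
  have shift: "norm (s *\<^sub>R b) \<le> norm b" if "0 \<le> s" "s \<le> 1" for s
    using mult_right_mono[OF that(2) norm_ge_zero[of b]] that by simp
  have zero: "(\<integral>x. q n x \<partial>lborel) = 0" for n
  proof -
    have "integrable lborel (\<lambda>x. f (x + \<delta> n *\<^sub>R b))"
    proof (rule integrable_lborel_compact_support)
      show "continuous_on UNIV (\<lambda>x. f (x + \<delta> n *\<^sub>R b))"
        by (rule continuous_on_compose2[OF cont]) (auto intro!: continuous_intros)
      show "f (x + \<delta> n *\<^sub>R b) = 0" if x: "R + norm b < norm x" for x
      proof (rule supp)
        have "norm x - norm (\<delta> n *\<^sub>R b) \<le> norm (x + \<delta> n *\<^sub>R b)" by (rule norm_diff_ineq)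
        then show "R < norm (x + \<delta> n *\<^sub>R b)" using x shift[of "\<delta> n"] \<delta>[of n] by linarith
      qed
    qed
    then show ?thesis
      using intf by (simp add: q_def integral_lborel_translation)
  qed
  have "(\<lambda>n. \<integral>x. q n x \<partial>lborel) \<longlonglongrightarrow> (\<integral>x. f' x \<partial>lborel)"
  proof (rule integral_dominated_convergence)
    show "integrable lborel (\<lambda>x. indicator (cball 0 (R + norm b)) x *\<^sub>R B)"
      by (rule borel_integrable_compact) auto
    show "AE x in lborel. (\<lambda>n. q n x) \<longlonglongrightarrow> f' x"
    proof (rule AE_I2)
      fix x
      have "(\<lambda>h. (f (x + (0 + h) *\<^sub>R b) - f (x + 0 *\<^sub>R b)) / h) \<midarrow>0\<rightarrow> f' (x + 0 *\<^sub>R b)"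
        using der[of x 0] unfolding DERIV_def .
      then have lim: "(\<lambda>h. (f (x + h *\<^sub>R b) - f x) / h) \<midarrow>0\<rightarrow> f' x" by simp
      have "\<delta> \<longlonglongrightarrow> 0" unfolding \<delta>_def[abs_def] by (rule LIMSEQ_inverse_real_of_nat)
      then have "filterlim \<delta> (at 0) sequentially"
        using \<delta>(1) by (intro filterlim_atI) (auto intro!: always_eventually simp: less_imp_neq[symmetric])
      from filterlim_compose[OF lim this] show "(\<lambda>n. q n x) \<longlonglongrightarrow> f' x" by (simp add: q_def)
    qed
    show "AE x in lborel. norm (q n x) \<le> indicator (cball 0 (R + norm b)) x *\<^sub>R B" for n
    proof (rule AE_I2)
      fix x
      show "norm (q n x) \<le> indicator (cball 0 (R + norm b)) x *\<^sub>R B"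
      proof (cases "norm x \<le> R + norm b")
        case True
        have "\<exists>z>0. z < \<delta> n \<and> f (x + \<delta> n *\<^sub>R b) - f (x + 0 *\<^sub>R b) = (\<delta> n - 0) * f' (x + z *\<^sub>R b)"
          by (rule MVT2[OF \<delta>(1) der])
        then obtain z where z: "0 < z" "z < \<delta> n" "f (x + \<delta> n *\<^sub>R b) - f x = \<delta> n * f' (x + z *\<^sub>R b)"
          by auto
        have "q n x = f' (x + z *\<^sub>R b)" unfolding q_def z(3) using \<delta>(1)[of n] by simp
        moreover have "norm (x + z *\<^sub>R b) \<le> R + 2 * norm b"
          using norm_triangle_ineq[of x "z *\<^sub>R b"] shift[of z] z \<delta>(2)[of n] True by linarith
        ultimately show ?thesis using B[of "x + z *\<^sub>R b"] True by simp
      next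
        case False
        have "norm x - norm (\<delta> n *\<^sub>R b) \<le> norm (x + \<delta> n *\<^sub>R b)" by (rule norm_diff_ineq)
        then have "R < norm (x + \<delta> n *\<^sub>R b)" "R < norm x"
          using False shift[of "\<delta> n"] \<delta>[of n] norm_ge_zero[of b] by linarith+
        then have "f (x + \<delta> n *\<^sub>R b) = 0" "f x = 0" by (auto intro: supp)
        then show ?thesis using False by (simp add: q_def)
      qed
    qed
  qed measurable
  then show ?thesis by (simp add: zero LIMSEQ_const_iff)
qed

lemma gradient_inner_Basis: "b \<in> Basis \<Longrightarrow> gradient \<phi> x \<bullet> b = frechet_derivative \<phi> (at x) b"
  by (simp add: gradient_def inner_sum_left inner_Basis if_distrib[of "\<lambda>y. _ * y"] cong: if_cong)

lemma test_function_derivative: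
  assumes "test_function D \<phi>"
  shows "continuous_on UNIV \<phi>" "\<phi> differentiable (at x)"
    "continuous_on UNIV (\<lambda>x. frechet_derivative \<phi> (at x) v)" "x \<notin> D \<Longrightarrow> \<phi> x = 0"
proof -
  have "Ck 0 \<phi>" and C1: "Ck (Suc 0) \<phi>" using assms unfolding test_function_def by blast+
  then show "continuous_on UNIV \<phi>" "\<phi> differentiable (at x)"
    "continuous_on UNIV (\<lambda>x. frechet_derivative \<phi> (at x) v)" by simp_all
  show "x \<notin> D \<Longrightarrow> \<phi> x = 0" using assms closure_subset[of "{x. \<phi> x \<noteq> 0}"] by (auto simp: test_function_def)
qed

text \<open>For a unit coordinate vector \<open>b\<close>, the function \<open>(x \<bullet> b) \<phi>\<^sup>2\<close> has the derivative
  \<open>\<phi>\<^sup>2 + 2 (x \<bullet> b) \<phi> \<partial>\<^sub>b \<phi>\<close> in direction \<open>b\<close>, whose integral is zero. The second term is absorbed by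
  \<open>\<phi>\<^sup>2 / 2 + 2 R\<^sup>2 (\<partial>\<^sub>b \<phi>)\<^sup>2\<close>, where \<open>R\<close> bounds the norm on \<open>D\<close>.\<close>

lemma poincare_inequality:
  fixes D :: "'a::euclidean_space set"
  assumes "open D" and "bounded D"
  shows "\<exists>K. \<forall>\<phi>. test_function D \<phi> \<longrightarrow>
    L2_norm (lebesgue_on D) \<phi> \<le> K * L2_norm (lebesgue_on D) (gradient \<phi>)"
proof -
  obtain R where R: "\<And>x. x \<in> D \<Longrightarrow> norm x \<le> R" and R0: "0 < R"
    using \<open>bounded D\<close> by (meson bounded_pos)
  obtain b :: 'a where b: "b \<in> Basis" using nonempty_Basis by blast
  have D: "D \<in> sets borel" using \<open>open D\<close> by simp
  have "L2_norm (lebesgue_on D) \<phi> \<le> 2 * R * L2_norm (lebesgue_on D) (gradient \<phi>)"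
    if \<phi>: "test_function D \<phi>" for \<phi>
  proof -
    note test = test_function_derivative[OF \<phi>]
    define d where "d x = frechet_derivative \<phi> (at x) b" for x
    define g where "g x = (norm (gradient \<phi> x))\<^sup>2" for x
    have out: "\<phi> x = 0" if "R < norm x" for x using test(4)[of x] R[of x] that by force
    have dc: "continuous_on UNIV d" unfolding d_def by (rule test(3))
    have gc: "continuous_on UNIV g"
      unfolding g_def gradient_def by (intro continuous_intros test(3))
    have dg: "(d x)\<^sup>2 \<le> g x" for x
      using Basis_le_norm[OF b, of "gradient \<phi> x"] unfolding g_def d_def gradient_inner_Basis[OF b]
      by (metis abs_ge_zero power2_abs power_mono)
    have [measurable]: "\<phi> \<in> borel_measurable borel" "d \<in> borel_measurable borel" "g \<in> borel_measurable borel"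
      using test(1) dc gc by (auto intro: borel_measurable_continuous_onI)
    have "(\<integral>x. (\<phi> x)\<^sup>2 + 2 * (x \<bullet> b) * \<phi> x * d x \<partial>lborel) = 0"
    proof (rule integral_directional_derivative_eq_0[where f = "\<lambda>x. (x \<bullet> b) * (\<phi> x)\<^sup>2" and b = b and R = R])
      fix x s
      have lin: "((\<lambda>s. x + s *\<^sub>R b) has_derivative (\<lambda>h. h *\<^sub>R b)) (at s)"
        by (auto intro!: derivative_eq_intros)
      have "(\<phi> has_derivative frechet_derivative \<phi> (at (x + s *\<^sub>R b))) (at (x + s *\<^sub>R b))"
        using test(2) by (simp flip: frechet_derivative_works)
      from has_derivative_compose[OF lin this]
      have "((\<lambda>s. \<phi> (x + s *\<^sub>R b)) has_derivative (\<lambda>h. frechet_derivative \<phi> (at (x + s *\<^sub>R b)) (h *\<^sub>R b))) (at s)" .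
      moreover have "(\<lambda>h. frechet_derivative \<phi> (at (x + s *\<^sub>R b)) (h *\<^sub>R b)) = (*) (d (x + s *\<^sub>R b))"
        using linear_scale[OF linear_frechet_derivative[OF test(2)]] by (auto simp: d_def fun_eq_iff)
      ultimately have "((\<lambda>s. \<phi> (x + s *\<^sub>R b)) has_real_derivative d (x + s *\<^sub>R b)) (at s)"
        by (simp add: has_field_derivative_def)
      moreover have "((\<lambda>s. (x + s *\<^sub>R b) \<bullet> b) has_real_derivative 1) (at s)"
        using b by (auto intro!: derivative_eq_intros simp: inner_add_left)
      ultimately have "((\<lambda>s. ((x + s *\<^sub>R b) \<bullet> b) * (\<phi> (x + s *\<^sub>R b) * \<phi> (x + s *\<^sub>R b))) has_real_derivative
          1 * (\<phi> (x + s *\<^sub>R b) * \<phi> (x + s *\<^sub>R b)) +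
          (d (x + s *\<^sub>R b) * \<phi> (x + s *\<^sub>R b) + d (x + s *\<^sub>R b) * \<phi> (x + s *\<^sub>R b)) * ((x + s *\<^sub>R b) \<bullet> b)) (at s)"
        by (intro DERIV_mult)
      then show "((\<lambda>s. ((x + s *\<^sub>R b) \<bullet> b) * (\<phi> (x + s *\<^sub>R b))\<^sup>2) has_real_derivative
          (\<phi> (x + s *\<^sub>R b))\<^sup>2 + 2 * ((x + s *\<^sub>R b) \<bullet> b) * \<phi> (x + s *\<^sub>R b) * d (x + s *\<^sub>R b)) (at s)"
        unfolding power2_eq_square by (rule DERIV_cong) (simp add: algebra_simps)
    qed (intro continuous_intros test(1) dc | simp add: out)+
    moreover have int1: "integrable lborel (\<lambda>x. (\<phi> x)\<^sup>2)"
      by (rule integrable_lborel_compact_support[where R = R]) (intro continuous_intros test(1) | simp add: out)+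
    moreover have int2: "integrable lborel (\<lambda>x. 2 * (x \<bullet> b) * \<phi> x * d x)"
      by (rule integrable_lborel_compact_support[where R = R]) (intro continuous_intros test(1) dc | simp add: out)+
    ultimately have eq: "(\<integral>x. (\<phi> x)\<^sup>2 \<partial>lborel) = (\<integral>x. - (2 * (x \<bullet> b) * \<phi> x * d x) \<partial>lborel)"
      by simp
    have int3: "integrable lborel (\<lambda>x. indicator D x * g x)"
    proof -
      have "integrable lborel (\<lambda>x. indicator (cball 0 R) x *\<^sub>R g x)"
        by (rule borel_integrable_compact) (use gc in \<open>auto intro: continuous_on_subset\<close>)
      then have "integrable lborel (\<lambda>x. indicator D x *\<^sub>R (indicator (cball 0 R) x *\<^sub>R g x))"
        by (rule integrable_mult_indicator[rotated]) (use D in simp)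
      also have "(\<lambda>x. indicator D x *\<^sub>R (indicator (cball 0 R) x *\<^sub>R g x)) = (\<lambda>x. indicator D x * g x)"
        using R by (auto simp: fun_eq_iff indicator_def)
      finally show ?thesis .
    qed
    have "(\<integral>x. (\<phi> x)\<^sup>2 \<partial>lborel) \<le> (\<integral>x. (\<phi> x)\<^sup>2 / 2 + 2 * R\<^sup>2 * (indicator D x * g x) \<partial>lborel)"
      unfolding eq
    proof (rule integral_mono)
      fix x
      show "- (2 * (x \<bullet> b) * \<phi> x * d x) \<le> (\<phi> x)\<^sup>2 / 2 + 2 * R\<^sup>2 * (indicator D x * g x)"
      proof (cases "x \<in> D")
        case True
        have "\<bar>x \<bullet> b\<bar> \<le> R" using Basis_le_norm[OF b, of x] R[OF True] by simp
        then have "(x \<bullet> b)\<^sup>2 \<le> R\<^sup>2" by (metis abs_ge_zero power2_abs power_mono)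
        then have "(x \<bullet> b)\<^sup>2 * (d x)\<^sup>2 \<le> R\<^sup>2 * g x" using dg by (intro mult_mono) auto
        moreover have "0 \<le> (\<phi> x + 2 * ((x \<bullet> b) * d x))\<^sup>2" by simp
        ultimately show ?thesis using True by (simp add: power2_sum power_mult_distrib algebra_simps)
      qed (simp add: test(4))
    qed (use int1 int2 int3 in auto)
    also have "\<dots> = (\<integral>x. (\<phi> x)\<^sup>2 \<partial>lborel) / 2 + 2 * R\<^sup>2 * (\<integral>x. indicator D x * g x \<partial>lborel)"
      using int1 int3 by simp
    finally have le: "(\<integral>x. (\<phi> x)\<^sup>2 \<partial>lborel) \<le> 4 * R\<^sup>2 * (\<integral>x. indicator D x * g x \<partial>lborel)" by simp
    have "(L2_norm (lebesgue_on D) \<phi>)\<^sup>2 = (\<integral>x. indicator D x * (\<phi> x)\<^sup>2 \<partial>lborel)"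
      unfolding L2_norm_squared using D by (simp add: integral_lebesgue_on_borel)
    also have "\<dots> = (\<integral>x. (\<phi> x)\<^sup>2 \<partial>lborel)"
      by (intro Bochner_Integration.integral_cong refl) (use test(4) in \<open>auto simp: indicator_def\<close>)
    also note le
    also have "(\<integral>x. indicator D x * g x \<partial>lborel) = (L2_norm (lebesgue_on D) (gradient \<phi>))\<^sup>2"
      unfolding L2_norm_squared g_def[symmetric] using D by (simp add: integral_lebesgue_on_borel)
    finally have "(L2_norm (lebesgue_on D) \<phi>)\<^sup>2 \<le> (2 * R * L2_norm (lebesgue_on D) (gradient \<phi>))\<^sup>2"
      by (simp add: power_mult_distrib)
    then show ?thesis
      by (rule power2_le_imp_le) (use R0 in \<open>simp add: L2_norm_nonneg\<close>)
  qed
  then show ?thesis by blast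
qed

text \<open>Testing the equation with the test functions that approximate \<open>u\<close> gives
  \<open>\<parallel>G\<parallel>\<^sup>2 = \<mu> \<parallel>u\<parallel>\<^sup>2\<close>. If \<open>\<mu> \<le> 0\<close> then \<open>G = 0\<close>, and the Poincare inequality, passed to the limit, forces
  \<open>u = 0\<close>.\<close>

lemma dirichlet_eigenvalue_pos:
  fixes D :: "'a::euclidean_space set"
  assumes D: "open D" "bounded D" and u: "u \<in> eigenspace D \<mu>"
    and nz: "\<not> (AE x in lebesgue_on D. u x = 0)"
  shows "0 < \<mu>"
proof (rule ccontr)
  assume "\<not> 0 < \<mu>"
  let ?M = "lebesgue_on D"
  obtain G where H: "H10 D u G" and weak: "\<And>\<phi>. test_function D \<phi> \<Longrightarrow>
      (\<integral>x. G x \<bullet> gradient \<phi> x \<partial>?M) = (\<integral>x. (\<mu> * u x) * \<phi> x \<partial>?M)"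
    using u unfolding eigenspace_def dirichlet_laplacian_def by auto
  obtain \<phi> where \<phi>: "\<And>n. test_function D (\<phi> n)" and cu: "L2_converges ?M \<phi> u"
    and cG: "L2_converges ?M (\<lambda>n. gradient (\<phi> n)) G"
    using H unfolding H10_def by auto
  have L: "L2 ?M u" "L2 ?M G" using cu cG by (auto simp: L2_converges_def)
  have "(\<lambda>n. \<integral>x. G x \<bullet> gradient (\<phi> n) x \<partial>?M) \<longlonglongrightarrow> (\<integral>x. G x \<bullet> G x \<partial>?M)"
    by (rule L2_inner_tendsto[OF cG L(2)])
  moreover have "(\<integral>x. G x \<bullet> gradient (\<phi> n) x \<partial>?M) = (\<integral>x. (\<mu> * u x) \<bullet> \<phi> n x \<partial>?M)" for n
    using weak[OF \<phi>] by simp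
  moreover have "(\<lambda>n. \<integral>x. (\<mu> * u x) \<bullet> \<phi> n x \<partial>?M) \<longlonglongrightarrow> (\<integral>x. (\<mu> * u x) \<bullet> u x \<partial>?M)"
    by (rule L2_inner_tendsto[OF cu L2_cmult[OF L(1)]])
  ultimately have "(\<integral>x. G x \<bullet> G x \<partial>?M) = (\<integral>x. (\<mu> * u x) \<bullet> u x \<partial>?M)"
    using LIMSEQ_unique by auto
  also have "(\<integral>x. (\<mu> * u x) \<bullet> u x \<partial>?M) = \<mu> * (L2_norm ?M u)\<^sup>2"
    by (simp add: L2_norm_squared mult.assoc flip: power2_eq_square)
  finally have "(L2_norm ?M G)\<^sup>2 = \<mu> * (L2_norm ?M u)\<^sup>2"
    by (simp add: L2_norm_squared dot_square_norm)
  then have "(L2_norm ?M G)\<^sup>2 \<le> 0"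
    using \<open>\<not> 0 < \<mu>\<close> by (simp add: mult_nonpos_nonneg)
  then have G0: "L2_norm ?M G = 0" by simp
  obtain K where K: "\<And>\<phi>. test_function D \<phi> \<Longrightarrow> L2_norm ?M \<phi> \<le> K * L2_norm ?M (gradient \<phi>)"
    using poincare_inequality[OF D] by blast
  have "(\<lambda>n. K * L2_norm ?M (gradient (\<phi> n))) \<longlonglongrightarrow> K * 0"
    using L2_norm_tendsto[OF cG] G0 by (intro tendsto_mult tendsto_const) simp
  then have "L2_norm ?M u \<le> K * 0"
    by (rule LIMSEQ_le[OF L2_norm_tendsto[OF cu]]) (use K[OF \<phi>] in blast)
  then have "L2_norm ?M u = 0" using L2_norm_nonneg[of ?M u] by simp
  then show False using L2_norm_eq_0_AE[OF L(1)] nz by simp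
qed

text \<open>The eigenspace of \<open>lam 1\<close> has positive dimension, because the index \<open>1\<close> is counted in its
  multiplicity.\<close>

lemma first_dirichlet_eigenvalue_pos:
  assumes D: "open D" "bounded D" and lam: "dirichlet_eigenvalues D lam"
  shows "0 < lam 1"
proof -
  let ?I = "{k. 1 \<le> k \<and> lam k = lam 1}"
  have fin: "finite ?I" and dim: "eigenspace_has_dim D (lam 1) (card ?I)"
    using lam unfolding dirichlet_eigenvalues_def by blast+
  have "1 \<in> ?I" by simp
  then have n: "0 < card ?I" using fin card_gt_0_iff by blast
  obtain b :: "nat \<Rightarrow> 'a \<Rightarrow> real" where b: "\<And>i. i < card ?I \<Longrightarrow> b i \<in> eigenspace D (lam 1)"
    and indep: "\<And>c. (AE x in lebesgue_on D. (\<Sum>i<card ?I. c i * b i x) = 0) \<Longrightarrow> \<forall>i<card ?I. c i = 0"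
    using dim unfolding eigenspace_has_dim_def by blast
  show ?thesis
  proof (rule dirichlet_eigenvalue_pos[OF D b[OF n]])
    show "\<not> (AE x in lebesgue_on D. b 0 x = 0)"
    proof
      assume "AE x in lebesgue_on D. b 0 x = 0"
      moreover have "(\<Sum>i<card ?I. (if i = 0 then 1 else 0) * b i x) = b 0 x" for x
        using n by (simp add: if_distrib[of "\<lambda>y. y * _"] cong: if_cong)
      ultimately have "\<forall>i<card ?I. (if i = 0 then 1 else 0 :: real) = 0"
        by (intro indep) simp
      then show False using n by auto
    qed
  qed
qed

section \<open>The two estimates\<close>

lemma integral_reversed_powr_bound:
  fixes e h :: "real \<Rightarrow> real"
  assumes t: "0 < t" and \<beta>: "\<beta> < 1" and B: "AE r in lebesgue_on {0..t}. \<bar>h r\<bar> \<le> B" and c: "0 \<le> c"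
    and e: "\<And>\<tau>. 0 < \<tau> \<Longrightarrow> \<bar>e \<tau>\<bar> \<le> c * \<tau> powr (- \<beta>)"
  shows "\<bar>\<integral>r. e (t - r) * h r \<partial>lebesgue_on {0..t}\<bar> \<le> c * B * (t powr (1 - \<beta>) / (1 - \<beta>))"
proof -
  let ?M = "lebesgue_on {0..t}"
  define w where "w r = (t - r) powr (- \<beta>)" for r
  have w: "(w has_integral (t powr (1 - \<beta>) / (1 - \<beta>))) {0..t}"
  proof -
    have "(w has_integral (- ((t - t) powr (1 - \<beta>) / (1 - \<beta>)) - - ((t - 0) powr (1 - \<beta>) / (1 - \<beta>)))) {0..t}"
    proof (rule fundamental_theorem_of_calculus_interior)
      show "continuous_on {0..t} (\<lambda>r. - ((t - r) powr (1 - \<beta>) / (1 - \<beta>)))"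
        using \<beta> by (intro continuous_intros continuous_on_powr') auto
      fix r assume r: "r \<in> {0<..<t}"
      have "((\<lambda>x. x powr (1 - \<beta>)) has_real_derivative (1 - \<beta>) * (t - r) powr (1 - \<beta> - 1)) (at (t - r))"
        using r by (intro has_real_derivative_powr) simp
      then have "((\<lambda>r. (t - r) powr (1 - \<beta>)) has_real_derivative (1 - \<beta>) * (t - r) powr (1 - \<beta> - 1) * (- 1)) (at r)"
        by (rule DERIV_chain2) (auto intro!: derivative_eq_intros)
      from DERIV_minus[OF DERIV_cdivide[OF this, of "1 - \<beta>"]]
      show "((\<lambda>r. - ((t - r) powr (1 - \<beta>) / (1 - \<beta>))) has_vector_derivative w r) (at r)"
        unfolding has_real_derivative_iff_has_vector_derivative[symmetric]
        by (rule DERIV_cong) (use \<beta> in \<open>simp add: w_def\<close>)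
    qed (use t in simp)
    then show ?thesis by simp
  qed
  have "w absolutely_integrable_on {0..t}"
    using w by (intro nonnegative_absolutely_integrable_1) (auto simp: w_def)
  then have int: "integrable ?M w" by (rule absolutely_integrable_imp_integrable) simp
  have val: "(\<integral>r. w r \<partial>?M) = t powr (1 - \<beta>) / (1 - \<beta>)"
    using lebesgue_integral_eq_integral[OF int] integral_unique[OF w] by simp
  have AE: "AE r in ?M. \<bar>e (t - r) * h r\<bar> \<le> c * B * w r"
  proof -
    have "AE r in lebesgue. r \<noteq> t" by (rule AE_completion[OF AE_lborel_singleton])
    then have "AE r in ?M. r \<noteq> t"
      by (subst AE_restrict_space_iff) (simp, erule eventually_mono, simp)
    moreover have "AE r in ?M. r \<in> {0..t}" by (rule AE_I2) simp
    ultimately show ?thesis using B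
    proof eventually_elim
      case (elim r)
      have "\<bar>e (t - r)\<bar> * \<bar>h r\<bar> \<le> (c * w r) * B"
        unfolding w_def using elim c by (intro mult_mono e) auto
      then show ?case by (simp add: abs_mult mult_ac)
    qed
  qed
  have "\<bar>\<integral>r. e (t - r) * h r \<partial>?M\<bar> \<le> (\<integral>r. \<bar>e (t - r) * h r\<bar> \<partial>?M)"
    by (rule integral_abs_bound)
  also have "\<dots> \<le> (\<integral>r. c * B * w r \<partial>?M)"
  proof (rule integral_mono_AE'[OF _ AE])
    show "integrable ?M (\<lambda>r. c * B * w r)" using int by simp
    show "AE r in ?M. 0 \<le> c * B * w r" using AE by eventually_elim (meson order_trans abs_ge_zero)
  qed
  finally show ?thesis by (simp add: val)
qed

theorem theorem4p2:
  fixes T \<alpha> s H C\<^sub>h :: real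
    and D :: "'a::euclidean_space set"
    and f g :: "'a \<Rightarrow> real"
    and h :: "real \<Rightarrow> real"
    and lam :: "nat \<Rightarrow> real"
    and M :: "'w measure"
    and W :: "real \<Rightarrow> 'w \<Rightarrow> real"
  assumes "0 < T" and "0 < \<alpha>" "\<alpha> < 1" and "0 < s" "s < 1" and "0 < H" "H < 1"
    and "bounded_lipschitz_domain D"
    and "dirichlet_eigenvalues D lam"
    and "prob_space M" and "complete_measure M"
    and "fractional_brownian_motion M H W"
    and "Linfty (lebesgue_on {0..T}) h"
    and "0 < C\<^sub>h" and "AE t in lebesgue_on {0<..<T}. C\<^sub>h \<le> h t"
    and "L2 (lebesgue_on D) f" and "L2 (lebesgue_on D) g"
    and "L2_norm (lebesgue_on D) g \<noteq> 0"
  shows "\<forall>\<sigma>\<^sub>1\<in>{0..1}. \<forall>\<epsilon>>0. \<forall>\<sigma>\<^sub>2\<in>{0..min (H / \<alpha> - \<epsilon>) 1}.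
    \<exists>C>0. \<forall>t\<in>{0<..T}. \<forall>k\<ge>1. \<forall>l\<ge>1.
      \<bar>\<integral>r. mittag_leffler \<alpha> 1 (- (lam k powr s) * (t - r) powr \<alpha>) * h r \<partial>lebesgue_on {0..t}\<bar>
        \<le> C * lam k powr (- (\<sigma>\<^sub>1 * s)) \<and>
      (\<integral>\<omega>. wiener_integral M W t (\<lambda>r. mittag_leffler \<alpha> 1 (- (lam k powr s) * (t - r) powr \<alpha>)) \<omega> *
            wiener_integral M W t (\<lambda>r. mittag_leffler \<alpha> 1 (- (lam l powr s) * (t - r) powr \<alpha>)) \<omega> \<partial>M)
        \<le> C * lam k powr (- (\<sigma>\<^sub>2 * s)) * lam l powr (- (\<sigma>\<^sub>2 * s))"
proof (intro ballI allI impI)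
  fix \<sigma>\<^sub>1 \<epsilon> \<sigma>\<^sub>2 :: real
  assume \<sigma>1: "\<sigma>\<^sub>1 \<in> {0..1}" and \<epsilon>: "0 < \<epsilon>" and \<sigma>2: "\<sigma>\<^sub>2 \<in> {0..min (H / \<alpha> - \<epsilon>) 1}"
  note T = \<open>0 < T\<close> and \<alpha> = \<open>0 < \<alpha>\<close> \<open>\<alpha> < 1\<close> and H = \<open>0 < H\<close>
    and M = \<open>prob_space M\<close> and fbm = \<open>fractional_brownian_motion M H W\<close>
  have D: "open D" "bounded D" using \<open>bounded_lipschitz_domain D\<close> by (auto simp: bounded_lipschitz_domain_def)
  have lam: "0 < lam k" if "1 \<le> k" for k
  proof -
    have "lam 1 \<le> lam k"
      using \<open>dirichlet_eigenvalues D lam\<close> that unfolding dirichlet_eigenvalues_def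
      by (auto intro: mono_onD)
    then show ?thesis
      using first_dirichlet_eigenvalue_pos[OF D \<open>dirichlet_eigenvalues D lam\<close>] by linarith
  qed
  have \<mu>: "0 < lam k powr s" if "1 \<le> k" for k using lam[OF that] by simp
  have \<mu>_powr: "(lam k powr s) powr (- \<sigma>) = lam k powr (- (\<sigma> * s))" for k \<sigma>
    by (simp add: powr_powr mult.commute)
  define \<Gamma> where "\<Gamma> = Gamma (\<alpha> + 1)"
  have s1: "0 \<le> \<sigma>\<^sub>1" "\<sigma>\<^sub>1 \<le> 1" and s2: "0 \<le> \<sigma>\<^sub>2" "\<sigma>\<^sub>2 \<le> 1" using \<sigma>1 \<sigma>2 by auto
  have \<beta>1: "\<alpha> * \<sigma>\<^sub>1 < 1" using mult_left_mono[OF s1(2), of \<alpha>] \<alpha> by linarith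
  have \<beta>2: "0 \<le> \<alpha> * \<sigma>\<^sub>2" "\<alpha> * \<sigma>\<^sub>2 < H"
  proof -
    have "\<sigma>\<^sub>2 < H / \<alpha>" using \<sigma>2 \<epsilon> by simp
    then show "\<alpha> * \<sigma>\<^sub>2 < H" using \<alpha> by (simp add: field_simps)
  qed (use \<alpha> s2 in simp)
  obtain B0 where B0: "AE r in lebesgue_on {0..T}. \<bar>h r\<bar> \<le> B0"
    using \<open>Linfty _ h\<close> by (auto simp: Linfty_def)
  define B where "B = \<bar>B0\<bar>"
  have hB: "AE r in lebesgue_on {0..t}. \<bar>h r\<bar> \<le> B" if "t \<le> T" for t
  proof -
    have "AE r in lebesgue. r \<in> {0..T} \<longrightarrow> \<bar>h r\<bar> \<le> B0"
      using B0 by (subst (asm) AE_restrict_space_iff) auto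
    then show ?thesis
      by (subst AE_restrict_space_iff) (use that in \<open>auto simp: B_def elim!: eventually_mono\<close>)
  qed
  \<comment> \<open>\<open>C1\<close> and \<open>K\<close> are the constants of the two estimates, with the worst case \<open>t = T\<close> inserted\<close>
  define C1 where "C1 = \<Gamma> powr \<sigma>\<^sub>1 * B * (T powr (1 - \<alpha> * \<sigma>\<^sub>1) / (1 - \<alpha> * \<sigma>\<^sub>1))"
  define K where "K = \<Gamma> powr \<sigma>\<^sub>2 * (H / (H - \<alpha> * \<sigma>\<^sub>2)) * T powr (H - \<alpha> * \<sigma>\<^sub>2)"
  have C1: "0 \<le> C1" using \<beta>1 by (simp add: C1_def B_def)
  have K: "0 \<le> K" using \<beta>2 H by (simp add: K_def)
  define X where "X t k = wiener_integral M W t (\<lambda>r. relaxation \<alpha> (lam k powr s) (t - r))" for t k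
  have drift: "\<bar>\<integral>r. relaxation \<alpha> (lam k powr s) (t - r) * h r \<partial>lebesgue_on {0..t}\<bar> \<le> C1 * lam k powr (- (\<sigma>\<^sub>1 * s))"
    if t: "0 < t" "t \<le> T" and k: "1 \<le> k" for t k
  proof -
    have "\<bar>\<integral>r. relaxation \<alpha> (lam k powr s) (t - r) * h r \<partial>lebesgue_on {0..t}\<bar>
        \<le> \<Gamma> powr \<sigma>\<^sub>1 * (lam k powr s) powr (- \<sigma>\<^sub>1) * B * (t powr (1 - \<alpha> * \<sigma>\<^sub>1) / (1 - \<alpha> * \<sigma>\<^sub>1))"
      using relaxation_decay[OF \<alpha> \<mu>[OF k] s1] relaxation_nonneg[OF \<alpha> \<mu>[OF k]]
      by (intro integral_reversed_powr_bound t(1) \<beta>1 hB t(2)) (auto simp: \<Gamma>_def)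
    also have "\<dots> \<le> \<Gamma> powr \<sigma>\<^sub>1 * (lam k powr s) powr (- \<sigma>\<^sub>1) * B * (T powr (1 - \<alpha> * \<sigma>\<^sub>1) / (1 - \<alpha> * \<sigma>\<^sub>1))"
      using t \<beta>1 by (intro mult_left_mono divide_right_mono powr_mono2) (auto simp: B_def)
    finally show ?thesis by (simp add: C1_def \<mu>_powr mult_ac)
  qed
  have noise: "L2 M (X t k)" "L2_norm M (X t k) \<le> K * lam k powr (- (\<sigma>\<^sub>2 * s))"
    if t: "0 < t" "t \<le> T" and k: "1 \<le> k" for t k
  proof -
    have decay: "relaxation \<alpha> (lam k powr s) \<tau> \<le> \<Gamma> powr \<sigma>\<^sub>2 * (lam k powr s) powr (- \<sigma>\<^sub>2) * \<tau> powr (- (\<alpha> * \<sigma>\<^sub>2))"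
      if "0 < \<tau>" for \<tau>
      unfolding \<Gamma>_def by (rule relaxation_decay[OF \<alpha> \<mu>[OF k] s2 that])
    have "0 \<le> \<Gamma> powr \<sigma>\<^sub>2 * (lam k powr s) powr (- \<sigma>\<^sub>2)" by simp
    note X = wiener_integral_antimono[OF t(1) relaxation_nonneg[OF \<alpha> \<mu>[OF k]] relaxation_antimono[OF \<alpha> \<mu>[OF k]]
        M fbm H \<beta>2 this decay]
    show "L2 M (X t k)" unfolding X_def by (rule X(1))
    have "L2_norm M (X t k) \<le> \<Gamma> powr \<sigma>\<^sub>2 * (lam k powr s) powr (- \<sigma>\<^sub>2) * (H / (H - \<alpha> * \<sigma>\<^sub>2)) * t powr (H - \<alpha> * \<sigma>\<^sub>2)"
      unfolding X_def by (rule X(2))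
    also have "\<dots> \<le> \<Gamma> powr \<sigma>\<^sub>2 * (lam k powr s) powr (- \<sigma>\<^sub>2) * (H / (H - \<alpha> * \<sigma>\<^sub>2)) * T powr (H - \<alpha> * \<sigma>\<^sub>2)"
      using t \<beta>2 H by (intro mult_left_mono powr_mono2) auto
    finally show "L2_norm M (X t k) \<le> K * lam k powr (- (\<sigma>\<^sub>2 * s))"
      by (simp add: K_def \<mu>_powr mult_ac)
  qed
  define C where "C = C1 + K\<^sup>2 + 1"
  have C: "0 < C" "C1 \<le> C" "K\<^sup>2 \<le> C" using C1 zero_le_power2[of K] unfolding C_def by linarith+
  show "\<exists>C>0. \<forall>t\<in>{0<..T}. \<forall>k\<ge>1. \<forall>l\<ge>1.
      \<bar>\<integral>r. mittag_leffler \<alpha> 1 (- (lam k powr s) * (t - r) powr \<alpha>) * h r \<partial>lebesgue_on {0..t}\<bar>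
        \<le> C * lam k powr (- (\<sigma>\<^sub>1 * s)) \<and>
      (\<integral>\<omega>. wiener_integral M W t (\<lambda>r. mittag_leffler \<alpha> 1 (- (lam k powr s) * (t - r) powr \<alpha>)) \<omega> *
            wiener_integral M W t (\<lambda>r. mittag_leffler \<alpha> 1 (- (lam l powr s) * (t - r) powr \<alpha>)) \<omega> \<partial>M)
        \<le> C * lam k powr (- (\<sigma>\<^sub>2 * s)) * lam l powr (- (\<sigma>\<^sub>2 * s))"
    unfolding relaxation_def[symmetric] X_def[symmetric]
  proof (intro exI[of _ C] conjI C(1) ballI allI impI)
    fix t and k l :: nat
    assume "t \<in> {0<..T}" and k: "1 \<le> k" and l: "1 \<le> l"
    then have t: "0 < t" "t \<le> T" by auto
    show "\<bar>\<integral>r. relaxation \<alpha> (lam k powr s) (t - r) * h r \<partial>lebesgue_on {0..t}\<bar> \<le> C * lam k powr (- (\<sigma>\<^sub>1 * s))"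
      by (rule order_trans[OF drift[OF t k] mult_right_mono[OF C(2)]]) simp
    have "(\<integral>\<omega>. X t k \<omega> * X t l \<omega> \<partial>M) \<le> L2_norm M (X t k) * L2_norm M (X t l)"
      using L2_Cauchy_Schwarz[OF noise(1)[OF t k] noise(1)[OF t l]] by linarith
    also have "\<dots> \<le> (K * lam k powr (- (\<sigma>\<^sub>2 * s))) * (K * lam l powr (- (\<sigma>\<^sub>2 * s)))"
      using K by (intro mult_mono noise(2)[OF t k] noise(2)[OF t l]) (auto simp: L2_norm_nonneg)
    also have "\<dots> = K\<^sup>2 * (lam k powr (- (\<sigma>\<^sub>2 * s)) * lam l powr (- (\<sigma>\<^sub>2 * s)))"
      by (simp add: power2_eq_square)
    also have "\<dots> \<le> C * (lam k powr (- (\<sigma>\<^sub>2 * s)) * lam l powr (- (\<sigma>\<^sub>2 * s)))"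
      by (intro mult_right_mono C(3)) simp
    finally show "(\<integral>\<omega>. X t k \<omega> * X t l \<omega> \<partial>M) \<le> C * lam k powr (- (\<sigma>\<^sub>2 * s)) * lam l powr (- (\<sigma>\<^sub>2 * s))"
      by (simp only: mult.assoc)
  qed
qed

end
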